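(* Let $R$ be a skew-invertible involutive symmetry on $V\otimes V$, $\dim V=n$, let $r\ge2$ be an integer, and let $\mathcal{A}$ be the braided commutative algebra generated by the entries of the matrices $L^{(k)}(v)$, $k=0,1,2,\dots$, equipped with the braided Poisson bracket $\{\,,\,\}_r$, as defined in the context. Then the quantities $\operatorname{Tr}^R(L(v))^k$, $k=0,1,2,\dots$, commute with each other in the sense of this bracket: $$\{\operatorname{Tr}^R(L(v))^k,\ \operatorname{Tr}^R(L(v))^l\}_r=0\qquad\text{for all } k,l\ge0.$$
   Context: Let $V$ be a finite-dimensional complex vector space with a fixed basis, $\dim V=n$. A braiding is an operator $R:V^{\otimes2}\to V^{\otimes2}$ with $R_{12}R_{23}R_{12}=R_{23}R_{12}R_{23}$ on $V^{\otimes3}$, where $R_{12}=R\otimes I$, $R_{23}=I\otimes R$. It is an involutive symmetry if $R^2=I$. It is skew-invertible if there is $\Psi:V^{\otimes2}\to V^{\otimes2}$ with $\operatorname{Tr}_2R_{12}\Psi_{23}=\operatorname{Tr}_2\Psi_{12}R_{23}=P_{13}$, where $P$ is the flip and subscripts indicate the spaces where operators act or traces are taken. Put $C=\operatorname{Tr}_2\Psi:V\to V$. For an $n\times n$ matrix $A$ with entries in an algebra, the $R$-trace is $\operatorname{Tr}^RA=\operatorname{Tr}(C\cdot A)$, where $C$ denotes also the matrix of the operator $C$ and $\operatorname{Tr}$ is the usual trace. For an $n\times n$ matrix $M$ put $M_1=M\otimes I$, $M_{\overline1}=M_1$ and $M_{\overline2}=R\,M_1\,R^{-1}$ (with $R^{-1}=R$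 here). $A\odot B$ denotes the matrix product in which entries are multiplied by the tensor product: $(A\odot B)_i^j=\sum_kA_i^k\otimes B_k^j$. Similarly $\{A,B\}$ is the matrix with entries $\sum_k\{A_i^k,B_k^j\}$. $[\,,\,]$ is the matrix commutator. Let $L(v)=\|l_i^j(v)\|_{1\le i,j\le n}$ and let $L^{(k)}(v)$ be its $k$-th derivative in $v$, $L^{(0)}=L$; the entries of all $L^{(k)}(v)$ are treated as independent generators, at one and the same value $v$. On the span of the generators define the braiding $Q$ by $$Q\big(L^{(k)}_{\overline1}(v)\odot L^{(l)}_{\overline2}(v)\big)=L^{(l)}_{\overline2}(v)\odot L^{(k)}_{\overline1}(v),\qquad k,l\ge0.$$ It is involutive. The algebra $\mathcal{A}$ is the unital associative algebra generated by the entries of all $L^{(k)}(v)$ subject to the relations $L^{(k)}_{\overline1}(v)\,L^{(l)}_{\overline2}(v)=L^{(l)}_{\overline2}(v)\,L^{(k)}_{\overline1}(v)$ for all $k,l\ge0$. The braiding $Q$ extends to $\mathcal{A}\otimes\mathcal{A}$, compatibly with the product and with $Q(1\otimes a)=a\otimes1$, $Q(a\otimes 1)=1\otimes a$. $(L(v))^k$ is the matrix power, with entries multiplied in $\mathcal{A}$. The braided Poisson bracket $\{\,,\,\}_r:\mathcal{A}\otimes\mathcal{A}\to\mathcal{A}$ is defined on generators by $$\{L^{(k)}_{\overline1}(v),L^{(l)}_{\overline2}(v)\}_r=\alpha_r(k,l)\,[L^{(k+l+r)}_{\overline1}(v),R],\qquad \alpha_r(k,l)=\frac{(k+r-1)!\,(l+r-1)!}{(k+l+2r-1)!\,(r-1)!},$$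 and is extended to the whole algebra $\mathcal{A}$ via the coproduct $\Delta L^{(k)}(v)=L^{(k)}(v)\otimes1+1\otimes L^{(k)}(v)$ (extended to products by means of $Q$), that is, by the braided Leibniz rule $$\{a,bc\}=\{a,b\}\,c+\mu\,(\mathrm{id}\otimes\{\,,\,\})\,(Q\otimes\mathrm{id})(a\otimes b\otimes c),\qquad a,b,c\in\mathcal{A},$$ ($\mu$ is the product of $\mathcal{A}$) together with braided skew-symmetry $\{a,b\}=-\{\,,\,\}\,Q(a\otimes b)$; in particular $\{a,1\}=\{1,a\}=0$. *)

theory Defs
  imports "HOL-Analysis.Analysis" "HOL-Library.Poly_Mapping" "HOL-Library.Product_Plus"
begin

text \<open>
  \<open>V\<close> has a basis indexed by the finite type \<open>'n\<close>.  An operator on \<open>V\<^sup>\<otimes>\<^sup>2\<close> is identified with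
  its matrix, whose rows and columns are indexed by \<open>'n \<times> 'n\<close>; likewise for \<open>V\<^sup>\<otimes>\<^sup>3\<close> and
  \<open>'n \<times> 'n \<times> 'n\<close>.
\<close>

type_synonym 'n op1 = "complex ^ 'n ^ 'n"
type_synonym 'n op2 = "complex ^ ('n \<times> 'n) ^ ('n \<times> 'n)"
type_synonym 'n op3 = "complex ^ ('n \<times> 'n \<times> 'n) ^ ('n \<times> 'n \<times> 'n)"

definition on_12 :: "'n::finite op2 \<Rightarrow> 'n op3" where
  "on_12 X = (\<chi> I J. case (I, J) of ((a, b, c), (d, e, f)) \<Rightarrow>
     if c = f then X $ (a, b) $ (d, e) else 0)"

definition on_23 :: "'n::finite op2 \<Rightarrow> 'n op3" where
  "on_23 X = (\<chi> I J. case (I, J) of ((a, b, c), (d, e, f)) \<Rightarrow>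
     if a = d then X $ (b, c) $ (e, f) else 0)"

text \<open>\<open>ptrace2 X\<close> acts on the first and the third space; these are the two factors of its index.\<close>

definition ptrace2 :: "'n::finite op3 \<Rightarrow> 'n op2" where
  "ptrace2 X = (\<chi> I J. case (I, J) of ((a, c), (d, f)) \<Rightarrow>
     (\<Sum>b\<in>UNIV. X $ (a, b, c) $ (d, b, f)))"

definition flip_op :: "'n::finite op2" where
  "flip_op = (\<chi> I J. case (I, J) of ((a, b), (c, d)) \<Rightarrow> if a = d \<and> b = c then 1 else 0)"

definition braiding :: "'n::finite op2 \<Rightarrow> bool" where
  "braiding R \<longleftrightarrow> on_12 R ** on_23 R ** on_12 R = on_23 R ** on_12 R ** on_23 R"

definition involutive_symmetry :: "'n::finite op2 \<Rightarrow> bool" where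
  "involutive_symmetry R \<longleftrightarrow> braiding R \<and> R ** R = mat 1"

definition skew_inverse :: "'n::finite op2 \<Rightarrow> 'n op2 \<Rightarrow> bool" where
  "skew_inverse R \<Psi> \<longleftrightarrow>
     ptrace2 (on_12 R ** on_23 \<Psi>) = flip_op \<and> ptrace2 (on_12 \<Psi> ** on_23 R) = flip_op"

definition C_op :: "'n::finite op2 \<Rightarrow> 'n op1" where
  "C_op \<Psi> = (\<chi> a d. \<Sum>b\<in>UNIV. \<Psi> $ (a, b) $ (d, b))"

text \<open>
  Words form the free monoid, written additively because \<^typ>\<open>'k \<Rightarrow>\<^sub>0 complex\<close> is the monoid
  algebra of an additive monoid \<open>'k\<close>.
\<close>

datatype 'a fword = FWord "'a list"

instantiation fword :: (type) monoid_add
begin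

definition zero_fword :: "'a fword" where "zero_fword = FWord []"

fun plus_fword :: "'a fword \<Rightarrow> 'a fword \<Rightarrow> 'a fword" where
  "plus_fword (FWord xs) (FWord ys) = FWord (xs @ ys)"

instance
proof
  fix a b c :: "'a fword"
  show "a + b + c = a + (b + c)" by (cases a; cases b; cases c) simp
  show "0 + a = a" by (cases a) (simp add: zero_fword_def)
  show "a + 0 = a" by (cases a) (simp add: zero_fword_def)
qed

end

text \<open>
  \<open>Gen k i j\<close> stands for the entry \<open>(i, j)\<close> of \<open>L\<^sup>(\<^sup>k\<^sup>)(v)\<close>, the point \<open>v\<close> being fixed throughout.
  The free algebra \<open>T\<close> on these generators and the vector spaces \<open>T \<otimes> T\<close> and \<open>T \<otimes> T \<otimes> T\<close> are
  given by their bases of words, pairs and triples of words.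
\<close>

datatype 'n gen = Gen nat 'n 'n

type_synonym 'n wd = "'n gen fword"
type_synonym 'n falg = "'n wd \<Rightarrow>\<^sub>0 complex"
type_synonym 'n falg2 = "('n wd \<times> 'n wd) \<Rightarrow>\<^sub>0 complex"

definition scl :: "complex \<Rightarrow> ('k::monoid_add \<Rightarrow>\<^sub>0 complex) \<Rightarrow> ('k \<Rightarrow>\<^sub>0 complex)" where
  "scl c p = Poly_Mapping.single 0 c * p"

lemma vector_space_scl: "vector_space (scl :: complex \<Rightarrow> ('k::monoid_add \<Rightarrow>\<^sub>0 complex) \<Rightarrow> _)"
  by unfold_locales
     (simp_all add: scl_def algebra_simps single_add mult_single flip: mult.assoc)

definition lin_ext ::
    "('k \<Rightarrow> 'l::monoid_add \<Rightarrow>\<^sub>0 complex) \<Rightarrow> ('k \<Rightarrow>\<^sub>0 complex) \<Rightarrow> ('l \<Rightarrow>\<^sub>0 complex)" where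
  "lin_ext f t = (\<Sum>k\<in>Poly_Mapping.keys t. scl (Poly_Mapping.lookup t k) (f k))"

definition tens ::
    "('k \<Rightarrow>\<^sub>0 complex) \<Rightarrow> ('l \<Rightarrow>\<^sub>0 complex) \<Rightarrow> ('k \<times> 'l \<Rightarrow>\<^sub>0 complex)" (infixr "\<otimes>" 75) where
  "a \<otimes> b = (\<Sum>u\<in>Poly_Mapping.keys a. \<Sum>v\<in>Poly_Mapping.keys b.
     Poly_Mapping.single (u, v) (Poly_Mapping.lookup a u * Poly_Mapping.lookup b v))"

definition map_tens ::
    "(('k \<Rightarrow>\<^sub>0 complex) \<Rightarrow> ('k'::monoid_add \<Rightarrow>\<^sub>0 complex)) \<Rightarrow>
     (('l \<Rightarrow>\<^sub>0 complex) \<Rightarrow> ('l'::monoid_add \<Rightarrow>\<^sub>0 complex)) \<Rightarrow>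
     ('k \<times> 'l \<Rightarrow>\<^sub>0 complex) \<Rightarrow> ('k' \<times> 'l' \<Rightarrow>\<^sub>0 complex)" where
  "map_tens f g =
     lin_ext (\<lambda>(u, v). f (Poly_Mapping.single u 1) \<otimes> g (Poly_Mapping.single v 1))"

definition assoc_r ::
    "(('k::monoid_add \<times> 'l::monoid_add) \<times> 'm::monoid_add \<Rightarrow>\<^sub>0 complex) \<Rightarrow>
     ('k \<times> 'l \<times> 'm \<Rightarrow>\<^sub>0 complex)" where
  "assoc_r = lin_ext (\<lambda>((u, v), w). Poly_Mapping.single (u, v, w) 1)"

definition assoc_l ::
    "('k::monoid_add \<times> 'l::monoid_add \<times> 'm::monoid_add \<Rightarrow>\<^sub>0 complex) \<Rightarrow>
     (('k \<times> 'l) \<times> 'm \<Rightarrow>\<^sub>0 complex)" where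
  "assoc_l = lin_ext (\<lambda>(u, v, w). Poly_Mapping.single ((u, v), w) 1)"

definition mu :: "'n falg2 \<Rightarrow> 'n falg" where
  "mu = lin_ext (\<lambda>(u, v). Poly_Mapping.single (u + v) 1)"

definition Q_12 :: "('n falg2 \<Rightarrow> 'n falg2) \<Rightarrow>
    ('n wd \<times> 'n wd \<times> 'n wd \<Rightarrow>\<^sub>0 complex) \<Rightarrow> ('n wd \<times> 'n wd \<times> 'n wd \<Rightarrow>\<^sub>0 complex)" where
  "Q_12 Q t = assoc_r (map_tens Q id (assoc_l t))"

definition Q_23 :: "('n falg2 \<Rightarrow> 'n falg2) \<Rightarrow>
    ('n wd \<times> 'n wd \<times> 'n wd \<Rightarrow>\<^sub>0 complex) \<Rightarrow> ('n wd \<times> 'n wd \<times> 'n wd \<Rightarrow>\<^sub>0 complex)" where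
  "Q_23 Q t = map_tens id Q t"

definition const_mat :: "complex ^ 'a ^ 'b \<Rightarrow> ('k::monoid_add \<Rightarrow>\<^sub>0 complex) ^ 'a ^ 'b" where
  "const_mat M = (\<chi> i j. Poly_Mapping.single 0 (M $ i $ j))"

definition L_mat :: "nat \<Rightarrow> 'n falg ^ 'n ^ 'n" where
  "L_mat k = (\<chi> i j. Poly_Mapping.single (FWord [Gen k i j]) 1)"

definition bar1 :: "'n::finite falg ^ 'n ^ 'n \<Rightarrow> 'n falg ^ ('n \<times> 'n) ^ ('n \<times> 'n)" where
  "bar1 M = (\<chi> I J. if snd I = snd J then M $ fst I $ fst J else 0)"

definition bar2 :: "'n::finite op2 \<Rightarrow> 'n falg ^ 'n ^ 'n \<Rightarrow> 'n falg ^ ('n \<times> 'n) ^ ('n \<times> 'n)" where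
  "bar2 R M = const_mat R ** bar1 M ** const_mat (matrix_inv R)"

definition odot ::
    "'n falg ^ 'b::finite ^ 'a \<Rightarrow> 'n falg ^ 'c ^ 'b \<Rightarrow> 'n falg2 ^ 'c ^ 'a" (infixl "\<odot>" 70) where
  "A \<odot> B = (\<chi> i j. \<Sum>k\<in>UNIV. (A $ i $ k) \<otimes> (B $ k $ j))"

definition map_mat :: "('a \<Rightarrow> 'b) \<Rightarrow> 'a ^ 'c ^ 'd \<Rightarrow> 'b ^ 'c ^ 'd" where
  "map_mat f M = (\<chi> i j. f (M $ i $ j))"

definition mpow :: "('a::semiring_1) ^ 'n::finite ^ 'n \<Rightarrow> nat \<Rightarrow> 'a ^ 'n ^ 'n" where
  "mpow M k = (((**) M) ^^ k) (mat 1)"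

definition R_trace :: "'n::finite op2 \<Rightarrow> 'n falg ^ 'n ^ 'n \<Rightarrow> 'n falg" where
  "R_trace \<Psi> A = trace (const_mat (C_op \<Psi>) ** A)"

definition relators :: "'n::finite op2 \<Rightarrow> 'n falg set" where
  "relators R =
     {(bar1 (L_mat k) ** bar2 R (L_mat l) - bar2 R (L_mat l) ** bar1 (L_mat k)) $ I $ J | k l I J. True}"

definition rel_ideal :: "'n::finite op2 \<Rightarrow> 'n falg set" where
  "rel_ideal R = module.span scl {a * x * b | a x b. x \<in> relators R}"

text \<open>
  With \<open>\<I>\<close> the two-sided ideal \<^term>\<open>rel_ideal R\<close>, the algebra is \<open>\<A> = T / \<I>\<close>, and
  \<open>\<A> \<otimes> \<A> = (T \<otimes> T) / (\<I> \<otimes> T + T \<otimes> \<I>)\<close>.  Elements of these quotients are handled through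
  representatives, so equality in \<open>\<A>\<close> is \<open>alg_eq R\<close>, and equality in \<open>\<A> \<otimes> \<A>\<close> is \<open>alg2_eq R\<close>.
\<close>

definition rel_space2 :: "'n::finite op2 \<Rightarrow> 'n falg2 set" where
  "rel_space2 R = module.span scl {a \<otimes> b | a b. a \<in> rel_ideal R \<or> b \<in> rel_ideal R}"

definition alg_eq :: "'n::finite op2 \<Rightarrow> 'n falg \<Rightarrow> 'n falg \<Rightarrow> bool" where
  "alg_eq R x y \<longleftrightarrow> x - y \<in> rel_ideal R"

definition alg2_eq :: "'n::finite op2 \<Rightarrow> 'n falg2 \<Rightarrow> 'n falg2 \<Rightarrow> bool" where
  "alg2_eq R s t \<longleftrightarrow> s - t \<in> rel_space2 R"

text \<open>
  A linear map out of a quotient is the same as a linear map on representatives that respects the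
  equalities above, up to pointwise equality in the target; the following predicates describe
  \<open>Q : \<A> \<otimes> \<A> \<rightarrow> \<A> \<otimes> \<A>\<close> and \<open>{ , } : \<A> \<otimes> \<A> \<rightarrow> \<A>\<close> in this way.  The last two clauses of the first one
  say that \<open>Q\<close> is compatible with the product in either argument.
\<close>

definition algebra_braiding :: "'n::finite op2 \<Rightarrow> ('n falg2 \<Rightarrow> 'n falg2) \<Rightarrow> bool" where
  "algebra_braiding R Q \<longleftrightarrow>
     Vector_Spaces.linear scl scl Q \<and>
     (\<forall>s t. alg2_eq R s t \<longrightarrow> alg2_eq R (Q s) (Q t)) \<and>
     (\<forall>k l I J. alg2_eq R
        (map_mat Q (bar1 (L_mat k) \<odot> bar2 R (L_mat l)) $ I $ J)
        ((bar2 R (L_mat l) \<odot> bar1 (L_mat k)) $ I $ J)) \<and>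
     (\<forall>a. alg2_eq R (Q (1 \<otimes> a)) (a \<otimes> 1)) \<and>
     (\<forall>a. alg2_eq R (Q (a \<otimes> 1)) (1 \<otimes> a)) \<and>
     (\<forall>a b c. alg2_eq R (Q ((a * b) \<otimes> c))
        (map_tens id mu (Q_12 Q (Q_23 Q (a \<otimes> b \<otimes> c))))) \<and>
     (\<forall>a b c. alg2_eq R (Q (a \<otimes> (b * c)))
        (map_tens mu id (assoc_l (Q_23 Q (Q_12 Q (a \<otimes> b \<otimes> c))))))"

definition alpha :: "nat \<Rightarrow> nat \<Rightarrow> nat \<Rightarrow> complex" where
  "alpha r k l = (fact (k + r - 1) * fact (l + r - 1)) / (fact (k + l + 2 * r - 1) * fact (r - 1))"

text \<open>Here \<open>{a, b}\<close> is \<open>br (a \<otimes> b)\<close>.\<close>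

definition braided_bracket ::
    "'n::finite op2 \<Rightarrow> nat \<Rightarrow> ('n falg2 \<Rightarrow> 'n falg2) \<Rightarrow> ('n falg2 \<Rightarrow> 'n falg) \<Rightarrow> bool" where
  "braided_bracket R r Q br \<longleftrightarrow>
     Vector_Spaces.linear scl scl br \<and>
     (\<forall>s t. alg2_eq R s t \<longrightarrow> alg_eq R (br s) (br t)) \<and>
     (\<forall>k l I J. alg_eq R
        (map_mat br (bar1 (L_mat k) \<odot> bar2 R (L_mat l)) $ I $ J)
        (scl (alpha r k l)
          ((bar1 (L_mat (k + l + r)) ** const_mat R - const_mat R ** bar1 (L_mat (k + l + r))) $ I $ J))) \<and>
     (\<forall>a b c. alg_eq R (br (a \<otimes> (b * c)))
        (br (a \<otimes> b) * c + mu (map_tens id br (Q_12 Q (a \<otimes> b \<otimes> c))))) \<and>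
     (\<forall>a b. alg_eq R (br (a \<otimes> b)) (- br (Q (a \<otimes> b))))"

end

theory Submission
  imports Defs
begin

text \<open>
  Write \<open>L\<close> for \<open>L\<^sup>(\<^sup>0\<^sup>)(v)\<close> and \<open>X\<close> for \<open>L\<^sup>(\<^sup>r\<^sup>)(v)\<close>, write \<open>A\<^sub>1\<close> and \<open>B\<^sub>2'\<close> for \<open>bar1 A\<close> and
  \<open>bar2 R B = R B\<^sub>1 R\<close>, and let \<open>\<tau> M = Tr (C\<^sub>1 C\<^sub>2 M)\<close> for a matrix \<open>M\<close> over \<open>\<A>\<close> acting on
  \<open>V\<^sup>\<otimes>\<^sup>2\<close> (this is \<open>Rtrace2\<close>).  The proof moves the question from two traces to the single
  functional \<open>\<tau>\<close> and shows that \<open>\<tau>\<close> kills each term of the bracket of two powers.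

  The operator \<open>C\<close> has three properties: \<open>Tr\<^sub>2 (C\<^sub>2 R) = I\<close> (\<open>ptrace_C_R\<close>),
  \<open>Tr\<^sub>2 (C\<^sub>2 R M\<^sub>1 R) = Tr (C M) I\<close> (\<open>ptrace_C_R_conj\<close>), and \<open>R\<close> commutes with \<open>C\<^sub>1 C\<^sub>2\<close>
  (\<open>R_commutes_C_C\<close>).  They give, in this order, \<open>\<tau> (A\<^sub>1 R B\<^sub>1) = Tr\<^sup>R (A B)\<close>,
  \<open>{Tr\<^sup>R A, Tr\<^sup>R B} = \<tau> {A\<^sub>1, B\<^sub>2'}\<close> and \<open>\<tau> (R M) = \<tau> (M R)\<close>.  Since \<open>A\<^sub>1 B\<^sub>2' = B\<^sub>2' A\<^sub>1\<close> in \<open>\<A>\<close> when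
  \<open>A\<close> and \<open>B\<close> are products of the matrices \<open>L\<^sup>(\<^sup>k\<^sup>)(v)\<close>, the \<open>R\<close>-trace is cyclic on such products:
  \<open>Tr\<^sup>R (A B) = \<tau> (A\<^sub>1 B\<^sub>2' R) = \<tau> (B\<^sub>2' A\<^sub>1 R) = \<tau> (R B\<^sub>1 A\<^sub>2') = \<tau> (B\<^sub>1 A\<^sub>2' R) = Tr\<^sup>R (B A)\<close>.

  The braiding \<open>Q\<close> interchanges \<open>A\<^sub>1\<close> and \<open>B\<^sub>2'\<close> as whole matrices, so for matrix entries the braided
  Leibniz rule looks like the usual one (\<open>bracket_mat_leibniz\<close>).  Together with skew-symmetry, which
  trades the first argument for the second at the price of a conjugation by \<open>R\<close>, it expresses
  \<open>{(L\<^sup>k)\<^sub>1, (L\<^sup>l)\<^sub>2'}\<close> through terms \<open>U [X\<^sub>1, R] W\<close>, where \<open>U\<close> and \<open>W\<close> are products of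
  powers of \<open>L\<^sub>1\<close> and \<open>L\<^sub>2'\<close>.  Moving \<open>R\<close> to the right end (it turns \<open>A\<^sub>1\<close> into \<open>A\<^sub>2'\<close> on its way)
  and using cyclicity, both \<open>\<tau> (U X\<^sub>1 R W)\<close> and \<open>\<tau> (U R X\<^sub>1 W)\<close> become \<open>Tr\<^sup>R (X L\<^sup>N)\<close>, where \<open>N\<close> is the
  total degree of \<open>U\<close> and \<open>W\<close>, so they cancel (\<open>trace_null_commutator\<close>).
\<close>

section \<open>Linear and bilinear maps on monoid algebras\<close>

abbreviation scl_linear :: "(('k::monoid_add \<Rightarrow>\<^sub>0 complex) \<Rightarrow> ('l::monoid_add \<Rightarrow>\<^sub>0 complex)) \<Rightarrow> bool" where
  "scl_linear f \<equiv> Vector_Spaces.linear scl scl f"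

interpretation scl: vector_space "scl :: complex \<Rightarrow> ('k::monoid_add \<Rightarrow>\<^sub>0 complex) \<Rightarrow> _"
  by (rule vector_space_scl)

lemma scl_linearI:
  assumes "\<And>x y. f (x + y) = f x + f y" "\<And>c x. f (scl c x) = scl c (f x)"
  shows "scl_linear f"
  using assms by (unfold_locales) (auto simp: scl.scale_left_distrib scl.scale_right_distrib)

lemma scl_linear_module_hom: "scl_linear f \<Longrightarrow> module_hom scl scl f"
  by (simp add: module_hom_iff_linear)

lemmas scl_linear_add = module_hom.add[OF scl_linear_module_hom]
  and scl_linear_scl = module_hom.scale[OF scl_linear_module_hom]
  and scl_linear_zero = module_hom.zero[OF scl_linear_module_hom]
  and scl_linear_diff = module_hom.diff[OF scl_linear_module_hom]
  and scl_linear_sum = module_hom.sum[OF scl_linear_module_hom]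

lemma scl_linear_id: "scl_linear id"
  by (rule scl_linearI) auto

lemma scl_linear_compose:
  "scl_linear f \<Longrightarrow> scl_linear g \<Longrightarrow> scl_linear (\<lambda>x. g (f x))"
  by (rule scl_linearI) (simp_all add: scl_linear_add scl_linear_scl)

lemma scl_single: "scl c (Poly_Mapping.single k d) = Poly_Mapping.single k (c * d)"
  by (simp add: scl_def mult_single)

lemma lookup_scl: "Poly_Mapping.lookup (scl c x) k = c * Poly_Mapping.lookup x k"
  unfolding scl_def mult_map_scale_conv_mult[symmetric]
  by (simp add: Poly_Mapping.map.rep_eq when_def)

lemma poly_mapping_sum_single:
  "x = (\<Sum>k\<in>Poly_Mapping.keys x. Poly_Mapping.single k (Poly_Mapping.lookup x k))"
  by (rule poly_mapping_eqI)
     (auto simp: lookup_sum lookup_single when_def in_keys_iff sum.delta)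

lemma scl_linear_cong:
  assumes "scl_linear f" "scl_linear g"
    and "\<And>k. f (Poly_Mapping.single k 1) = g (Poly_Mapping.single k 1)"
  shows "f x = g x"
proof -
  have *: "h x = (\<Sum>k\<in>Poly_Mapping.keys x. scl (Poly_Mapping.lookup x k) (h (Poly_Mapping.single k 1)))"
    if "scl_linear h" for h :: "('a \<Rightarrow>\<^sub>0 complex) \<Rightarrow> ('b \<Rightarrow>\<^sub>0 complex)"
    using arg_cong[OF poly_mapping_sum_single[of x], of h] that
    by (simp add: scl_linear_sum scl_linear_scl[symmetric] scl_single)
  show ?thesis using *[OF assms(1)] *[OF assms(2)] assms(3) by simp
qed

text \<open>Support sets of different elements must be replaced by a common one before sums over them are added.\<close>

lemma sum_keys_mono:
  assumes "finite S" "Poly_Mapping.keys x \<subseteq> S" "\<And>k. f k 0 = (0::'b::comm_monoid_add)"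
  shows "(\<Sum>k\<in>Poly_Mapping.keys x. f k (Poly_Mapping.lookup x k)) = (\<Sum>k\<in>S. f k (Poly_Mapping.lookup x k))"
  by (rule sum.mono_neutral_left) (use assms in \<open>auto simp: in_keys_iff\<close>)

lemma lin_ext_linear: "scl_linear (lin_ext f)" for f :: "'k::monoid_add \<Rightarrow> 'l::monoid_add \<Rightarrow>\<^sub>0 complex"
proof (rule scl_linearI)
  have *: "lin_ext f t = (\<Sum>k\<in>S. scl (Poly_Mapping.lookup t k) (f k))"
    if "finite S" "Poly_Mapping.keys t \<subseteq> S" for t S
    unfolding lin_ext_def by (rule sum_keys_mono) (use that in auto)
  show "lin_ext f (x + y) = lin_ext f x + lin_ext f y" for x y
  proof -
    let ?S = "Poly_Mapping.keys x \<union> Poly_Mapping.keys y"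
    have "Poly_Mapping.keys (x + y) \<subseteq> ?S" by (rule keys_add)
    then show ?thesis
      by (simp add: *[of ?S] lookup_add scl.scale_left_distrib sum.distrib)
  qed
  show "lin_ext f (scl c x) = scl c (lin_ext f x)" for c x
  proof -
    have "Poly_Mapping.keys (scl c x) \<subseteq> Poly_Mapping.keys x"
      by (auto simp: in_keys_iff lookup_scl)
    then show ?thesis
      by (simp add: *[of "Poly_Mapping.keys x"] lookup_scl scl.scale_sum_right)
  qed
qed

lemma lin_ext_single: "lin_ext f (Poly_Mapping.single k c) = scl c (f k)"
  by (simp add: lin_ext_def)

lemma lookup_tens: "Poly_Mapping.lookup (a \<otimes> b) (u, v) = Poly_Mapping.lookup a u * Poly_Mapping.lookup b v"
proof -
  have "Poly_Mapping.lookup (a \<otimes> b) (u, v) =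
    (\<Sum>x\<in>Poly_Mapping.keys a. \<Sum>y\<in>Poly_Mapping.keys b.
       if x = u then (if y = v then Poly_Mapping.lookup a x * Poly_Mapping.lookup b y else 0) else 0)"
    unfolding tens_def lookup_sum by (intro sum.cong refl) (auto simp: lookup_single when_def)
  also have "\<dots> = (\<Sum>x\<in>Poly_Mapping.keys a. if x = u then
      (\<Sum>y\<in>Poly_Mapping.keys b. if y = v then Poly_Mapping.lookup a x * Poly_Mapping.lookup b y else 0) else 0)"
    by (intro sum.cong refl) auto
  also have "\<dots> = Poly_Mapping.lookup a u * Poly_Mapping.lookup b v"
    by (auto simp: sum.delta in_keys_iff)
  finally show ?thesis .
qed

lemma tens_linear_left: "scl_linear (\<lambda>a. a \<otimes> b)"
  by (rule scl_linearI; rule poly_mapping_eqI)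
     (auto simp: lookup_tens lookup_add lookup_scl algebra_simps split: prod.splits)

lemma tens_linear_right: "scl_linear (\<lambda>b. a \<otimes> b)"
  by (rule scl_linearI; rule poly_mapping_eqI)
     (auto simp: lookup_tens lookup_add lookup_scl algebra_simps split: prod.splits)

lemmas tens_scl_left = scl_linear_scl[OF tens_linear_left]
  and tens_scl_right = scl_linear_scl[OF tens_linear_right]
  and tens_zero_left [simp] = scl_linear_zero[OF tens_linear_left]
  and tens_zero_right [simp] = scl_linear_zero[OF tens_linear_right]
  and tens_sum_left = scl_linear_sum[OF tens_linear_left]
  and tens_sum_right = scl_linear_sum[OF tens_linear_right]

lemma tens_single: "Poly_Mapping.single u c \<otimes> Poly_Mapping.single v d = Poly_Mapping.single (u, v) (c * d)"
  by (rule poly_mapping_eqI) (auto simp: lookup_tens lookup_single when_def split: prod.splits if_splits)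

text \<open>
  The maps of the definitions are given on basis elements; this principle evaluates them on
  pure tensors of arbitrary elements.
\<close>

lemma scl_bilinear_cong:
  assumes "\<And>b. scl_linear (\<lambda>a. f a b)" "\<And>a. scl_linear (f a)"
    and "\<And>b. scl_linear (\<lambda>a. g a b)" "\<And>a. scl_linear (g a)"
    and "\<And>u v. f (Poly_Mapping.single u 1) (Poly_Mapping.single v 1) =
               g (Poly_Mapping.single u 1) (Poly_Mapping.single v 1)"
  shows "f a b = g a b"
proof -
  have "f (Poly_Mapping.single u 1) b = g (Poly_Mapping.single u 1) b" for u
    by (rule scl_linear_cong[OF assms(2) assms(4) assms(5)])
  then show ?thesis
    by (rule scl_linear_cong[of "\<lambda>a. f a b" "\<lambda>a. g a b", OF assms(1) assms(3)])
qed

lemma map_tens_linear: "scl_linear (map_tens f g)"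
  for f :: "('k::monoid_add \<Rightarrow>\<^sub>0 complex) \<Rightarrow> ('a::monoid_add \<Rightarrow>\<^sub>0 complex)"
  and g :: "('l::monoid_add \<Rightarrow>\<^sub>0 complex) \<Rightarrow> ('b::monoid_add \<Rightarrow>\<^sub>0 complex)"
  unfolding map_tens_def by (rule lin_ext_linear)

lemma map_tens_tens:
  assumes "scl_linear f" "scl_linear g"
  shows "map_tens f g (a \<otimes> b) = f a \<otimes> g b"
  by (rule scl_bilinear_cong)
     (auto intro!: scl_linear_compose[OF tens_linear_left map_tens_linear]
        scl_linear_compose[OF tens_linear_right map_tens_linear]
        scl_linear_compose[OF assms(1) tens_linear_left]
        scl_linear_compose[OF assms(2) tens_linear_right]
       simp: tens_single, simp add: map_tens_def lin_ext_single)

lemma mu_linear: "scl_linear mu"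
  unfolding mu_def by (rule lin_ext_linear)

lemma mult_linear_left: "scl_linear (\<lambda>x. x * y)"
  by (rule scl_linearI) (simp_all add: algebra_simps scl_def)

text \<open>Scalars act by multiplication with elements of degree \<open>0\<close>, and these are central.\<close>

lemma scl_mult_right: "x * scl c y = scl c (x * y)"
proof -
  have "x * Poly_Mapping.single 0 c = Poly_Mapping.single 0 c * x"
  proof (rule scl_linear_cong[where f = "\<lambda>x. x * Poly_Mapping.single 0 c" and g = "\<lambda>x. Poly_Mapping.single 0 c * x"])
    show "scl_linear ((*) (Poly_Mapping.single 0 c :: 'a \<Rightarrow>\<^sub>0 complex))"
      using scl.linear_scale_self[of c] by (simp add: scl_def[abs_def])
  qed (auto simp: mult_single intro: mult_linear_left)
  then show ?thesis by (simp add: scl_def mult.assoc[symmetric])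
qed

lemma scl_mult_left: "scl c x * y = scl c (x * y)"
  by (simp add: scl_def mult.assoc)

lemma mult_linear_right: "scl_linear (\<lambda>y. x * y)"
  by (rule scl_linearI) (simp_all add: algebra_simps scl_mult_right)

lemma mult_single_zero: "x * Poly_Mapping.single 0 c = scl c x"
  using scl_mult_right[of x c 1] by (simp add: scl_def)

lemma mu_tens: "mu (a \<otimes> b) = a * b"
  by (rule scl_bilinear_cong)
     (auto intro!: scl_linear_compose[OF tens_linear_left mu_linear]
        scl_linear_compose[OF tens_linear_right mu_linear] mult_linear_left mult_linear_right
       simp: tens_single mult_single, simp add: mu_def lin_ext_single)

lemma assoc_l_linear: "scl_linear assoc_l" and assoc_r_linear: "scl_linear assoc_r"
  unfolding assoc_l_def assoc_r_def by (rule lin_ext_linear)+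

lemma assoc_l_tens: "assoc_l (a \<otimes> b \<otimes> c) = (a \<otimes> b) \<otimes> c"
  for a :: "'k::monoid_add \<Rightarrow>\<^sub>0 complex" and b :: "'l::monoid_add \<Rightarrow>\<^sub>0 complex" and c :: "'m::monoid_add \<Rightarrow>\<^sub>0 complex"
proof -
  note lins = scl_linear_compose[OF scl_linear_compose[OF tens_linear_left tens_linear_right] assoc_l_linear]
    scl_linear_compose[OF scl_linear_compose[OF tens_linear_right tens_linear_right] assoc_l_linear]
    scl_linear_compose[OF tens_linear_left assoc_l_linear]
    scl_linear_compose[OF tens_linear_left tens_linear_left]
    scl_linear_compose[OF tens_linear_right tens_linear_left]
    tens_linear_right
  have "assoc_l (Poly_Mapping.single u 1 \<otimes> b \<otimes> c) = (Poly_Mapping.single u 1 \<otimes> b) \<otimes> c" for u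
    by (rule scl_bilinear_cong[where a=b and b=c]) (auto intro!: lins simp: tens_single, simp add: assoc_l_def lin_ext_single)
  then show ?thesis
    by (intro scl_linear_cong[where x = a and f = "\<lambda>a. assoc_l (a \<otimes> b \<otimes> c)"] lins) auto
qed

lemma assoc_r_tens: "assoc_r ((a \<otimes> b) \<otimes> c) = a \<otimes> b \<otimes> c"
  for a :: "'k::monoid_add \<Rightarrow>\<^sub>0 complex" and b :: "'l::monoid_add \<Rightarrow>\<^sub>0 complex" and c :: "'m::monoid_add \<Rightarrow>\<^sub>0 complex"
proof -
  have "assoc_r (assoc_l x) = x" for x :: "'k \<times> 'l \<times> 'm \<Rightarrow>\<^sub>0 complex"
  proof (rule scl_linear_cong[where f = "\<lambda>x. assoc_r (assoc_l x)" and g = id, simplified])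
    show "scl_linear (\<lambda>x::'k \<times> 'l \<times> 'm \<Rightarrow>\<^sub>0 complex. assoc_r (assoc_l x))"
      by (rule scl_linear_compose[OF assoc_l_linear assoc_r_linear])
  qed (auto simp: scl_linear_id assoc_l_def assoc_r_def lin_ext_single)
  from this[of "a \<otimes> b \<otimes> c"] show ?thesis by (simp add: assoc_l_tens)
qed

section \<open>The operator C of a skew-invertible involutive symmetry\<close>

lemma sum_UNIV_prod: "(\<Sum>p\<in>UNIV. f p) = (\<Sum>a\<in>UNIV. \<Sum>b\<in>UNIV. f (a, b))"
  for f :: "'a::finite \<times> 'b::finite \<Rightarrow> 'c::comm_monoid_add"
  by (simp add: sum.cartesian_product)

lemma sum_UNIV_delta [simp]:
  "(\<Sum>x\<in>UNIV. if a = x then f x else 0) = (f a :: 'c::comm_monoid_add)"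
  "(\<Sum>x\<in>UNIV. if x = a then f x else 0) = f a" for a :: "'a::finite"
  by (simp_all add: sum.delta sum.delta')

lemma mult_if_zero:
  "(if P then x else 0) * y = (if P then x * y else (0::'a::mult_zero))"
  "y * (if P then x else 0) = (if P then y * x else 0)"
  by auto

lemma sum_if_const: "(\<Sum>x\<in>A. if P then f x else 0) = (if P then sum f A else (0::'a::comm_monoid_add))"
  by auto

lemma skew_inverse_index:
  "skew_inverse R \<Psi> \<longleftrightarrow>
     (\<forall>a c d f. (\<Sum>b\<in>UNIV. \<Sum>x\<in>UNIV. R $ (a, b) $ (d, x) * \<Psi> $ (x, c) $ (b, f)) = (if a = f \<and> c = d then 1 else 0)) \<and>
     (\<forall>a c d f. (\<Sum>b\<in>UNIV. \<Sum>x\<in>UNIV. \<Psi> $ (a, b) $ (d, x) * R $ (x, c) $ (b, f)) = (if a = f \<and> c = d then 1 else 0))"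
proof -
  have *: "ptrace2 (on_12 X ** on_23 Y) $ (a, c) $ (d, f) = (\<Sum>b\<in>UNIV. \<Sum>x\<in>UNIV. X $ (a, b) $ (d, x) * Y $ (x, c) $ (b, f))"
    for X Y :: "'a op2" and a c d f
    by (simp add: ptrace2_def matrix_matrix_mult_def on_12_def on_23_def sum_UNIV_prod mult_if_zero sum_if_const)
  show ?thesis
    unfolding skew_inverse_def vec_eq_iff by (simp add: * flip_op_def)
qed

lemma braiding_index:
  assumes "braiding R"
  shows "(\<Sum>x\<in>UNIV. \<Sum>y\<in>UNIV. \<Sum>z\<in>UNIV. R $ (b, c) $ (x, y) * R $ (a, x) $ (d, z) * R $ (z, y) $ (e, f)) =
    (\<Sum>x\<in>UNIV. \<Sum>y\<in>UNIV. \<Sum>z\<in>UNIV. R $ (a, b) $ (x, y) * R $ (y, c) $ (z, f) * R $ (x, z) $ (d, e))"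
proof -
  have "(on_12 R ** on_23 R ** on_12 R) $ (a, b, c) $ (d, e, f) =
     (\<Sum>x\<in>UNIV. \<Sum>z\<in>UNIV. \<Sum>y\<in>UNIV. R $ (a, b) $ (x, y) * R $ (y, c) $ (z, f) * R $ (x, z) $ (d, e))"
    by (simp add: matrix_matrix_mult_def on_12_def on_23_def sum_UNIV_prod mult_if_zero sum_if_const sum_distrib_right)
  moreover have "(on_23 R ** on_12 R ** on_23 R) $ (a, b, c) $ (d, e, f) =
     (\<Sum>z\<in>UNIV. \<Sum>y\<in>UNIV. \<Sum>x\<in>UNIV. R $ (b, c) $ (x, y) * R $ (a, x) $ (d, z) * R $ (z, y) $ (e, f))"
    by (simp add: matrix_matrix_mult_def on_12_def on_23_def sum_UNIV_prod mult_if_zero sum_if_const sum_distrib_right)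
  moreover have "(\<Sum>x\<in>UNIV. \<Sum>z\<in>UNIV. \<Sum>y\<in>UNIV. R $ (a, b) $ (x, y) * R $ (y, c) $ (z, f) * R $ (x, z) $ (d, e)) =
      (\<Sum>x\<in>UNIV. \<Sum>y\<in>UNIV. \<Sum>z\<in>UNIV. R $ (a, b) $ (x, y) * R $ (y, c) $ (z, f) * R $ (x, z) $ (d, e))"
    by (rule sum.cong[OF refl], rule sum.swap)
  moreover have "(\<Sum>z\<in>UNIV. \<Sum>y\<in>UNIV. \<Sum>x\<in>UNIV. R $ (b, c) $ (x, y) * R $ (a, x) $ (d, z) * R $ (z, y) $ (e, f)) =
      (\<Sum>x\<in>UNIV. \<Sum>y\<in>UNIV. \<Sum>z\<in>UNIV. R $ (b, c) $ (x, y) * R $ (a, x) $ (d, z) * R $ (z, y) $ (e, f))"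
    by (simp only: sum.cartesian_product UNIV_Times_UNIV,
        rule sum.reindex_bij_witness[of _ "\<lambda>(x, y, z). (z, y, x)" "\<lambda>(z, y, x). (x, y, z)"]) auto
  ultimately show ?thesis
    using assms by (simp add: braiding_def)
qed

locale skew_invertible_symmetry =
  fixes R \<Psi> :: "'n::finite op2"
  assumes symm: "involutive_symmetry R" and skew: "skew_inverse R \<Psi>"
begin

abbreviation C where "C \<equiv> C_op \<Psi>"

lemma R_R: "R ** R = mat 1"
  using symm by (simp add: involutive_symmetry_def)

lemma matrix_inv_R: "matrix_inv R = R"
proof -
  have "R ** matrix_inv R = mat 1 \<and> matrix_inv R ** R = mat 1"
    unfolding matrix_inv_def by (rule someI[of _ R]) (simp add: R_R)
  then have "R ** R ** matrix_inv R = R ** mat 1"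
    by (simp add: matrix_mul_assoc[symmetric])
  then show ?thesis
    by (simp add: R_R)
qed

lemma R_R_index:
  "(\<Sum>x\<in>UNIV. \<Sum>y\<in>UNIV. R $ (a, b) $ (x, y) * R $ (x, y) $ (d, e)) = (if a = d \<and> b = e then 1 else 0)"
proof -
  have "(R ** R) $ (a, b) $ (d, e) = mat 1 $ (a, b) $ (d, e)" by (simp add: R_R)
  then show ?thesis
    by (simp add: matrix_matrix_mult_def sum_UNIV_prod mat_def)
qed

lemmas R_Psi = skew[unfolded skew_inverse_index, THEN conjunct1, rule_format]
  and Psi_R = skew[unfolded skew_inverse_index, THEN conjunct2, rule_format]
  and braid = braiding_index[OF conjunct1[OF symm[unfolded involutive_symmetry_def]]]

text \<open>Tracing out the third space in the first skew-inverse relation gives \<open>Tr\<^sub>2 (C\<^sub>2 R) = I\<close>.\<close>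

lemma ptrace_C_R: "(\<Sum>b\<in>UNIV. \<Sum>x\<in>UNIV. C $ b $ x * R $ (a, x) $ (d, b)) = (if a = d then 1 else 0)"
proof -
  have "(\<Sum>b\<in>UNIV. \<Sum>x\<in>UNIV. C $ b $ x * R $ (a, x) $ (d, b)) =
    (\<Sum>b\<in>UNIV. \<Sum>x\<in>UNIV. \<Sum>c\<in>UNIV. R $ (a, x) $ (d, b) * \<Psi> $ (b, c) $ (x, c))"
    by (simp add: C_op_def sum_distrib_left sum_distrib_right mult.commute)
  also have "\<dots> = (\<Sum>c\<in>UNIV. \<Sum>x\<in>UNIV. \<Sum>b\<in>UNIV. R $ (a, x) $ (d, b) * \<Psi> $ (b, c) $ (x, c))"
    by (simp only: sum.cartesian_product UNIV_Times_UNIV,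
        rule sum.reindex_bij_witness[of _ "\<lambda>(x, y, z). (z, y, x)" "\<lambda>(z, y, x). (x, y, z)"]) auto
  also have "\<dots> = (\<Sum>c\<in>UNIV. if c = a then (if a = d then 1 else 0) else 0)"
    unfolding R_Psi by (intro sum.cong) auto
  finally show ?thesis by (simp add: mult_if_zero)
qed

text \<open>
  By the second skew-inverse relation \<open>\<Psi>\<close> inverts the linear map \<open>Y \<mapsto> Tr\<^sub>1 (Y\<^sub>1 R)\<close> on operators,
  so a functional on operators is determined by its values on the image of this map.
\<close>

lemma R_faithful:
  fixes F :: "'n \<Rightarrow> 'n \<Rightarrow> complex"
  assumes "\<And>s t. (\<Sum>p\<in>UNIV. \<Sum>q\<in>UNIV. F p q * R $ (s, p) $ (t, q)) = (\<Sum>p\<in>UNIV. \<Sum>q\<in>UNIV. G p q * R $ (s, p) $ (t, q))"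
  shows "F v u = G v u"
proof -
  have *: "(\<Sum>t\<in>UNIV. \<Sum>s\<in>UNIV. \<Psi> $ (u, t) $ (v, s) * (\<Sum>p\<in>UNIV. \<Sum>q\<in>UNIV. F p q * R $ (s, p) $ (t, q))) = F v u"
    for F :: "'n \<Rightarrow> 'n \<Rightarrow> complex"
  proof -
    have "(\<Sum>t\<in>UNIV. \<Sum>s\<in>UNIV. \<Psi> $ (u, t) $ (v, s) * (\<Sum>p\<in>UNIV. \<Sum>q\<in>UNIV. F p q * R $ (s, p) $ (t, q))) =
      (\<Sum>t\<in>UNIV. \<Sum>s\<in>UNIV. \<Sum>p\<in>UNIV. \<Sum>q\<in>UNIV. F p q * (\<Psi> $ (u, t) $ (v, s) * R $ (s, p) $ (t, q)))"
      by (simp add: sum_distrib_left sum_distrib_right mult_ac)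
    also have "\<dots> = (\<Sum>p\<in>UNIV. \<Sum>q\<in>UNIV. \<Sum>t\<in>UNIV. \<Sum>s\<in>UNIV. F p q * (\<Psi> $ (u, t) $ (v, s) * R $ (s, p) $ (t, q)))"
      by (simp only: sum.cartesian_product UNIV_Times_UNIV,
        rule sum.reindex_bij_witness[of _ "\<lambda>(p, q, t, s). (t, s, p, q)" "\<lambda>(t, s, p, q). (p, q, t, s)"]) auto
    also have "\<dots> = (\<Sum>p\<in>UNIV. \<Sum>q\<in>UNIV. F p q * (if u = q \<and> p = v then 1 else 0))"
      by (simp only: sum_distrib_left[symmetric] Psi_R)
    also have "\<dots> = (\<Sum>p\<in>UNIV. if p = v then (\<Sum>q\<in>UNIV. if u = q then F p q else 0) else 0)"
      by (intro sum.cong refl) (auto simp: mult_if_zero)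
    finally show ?thesis by (simp add: mult_if_zero)
  qed
  show ?thesis
    using *[of F] *[of G] by (simp add: assms)
qed

text \<open>
  This is the entrywise form of \<open>Tr\<^sub>2 (C\<^sub>2 R M\<^sub>1 R) = Tr (C M) I\<close>.  It is enough to take
  \<open>M\<^sub>1 = Tr\<^sub>0 (Y\<^sub>0 R\<^sub>0\<^sub>1)\<close>.  There the braid relation gives
  \<open>Tr\<^sub>2 (C\<^sub>2 R\<^sub>1\<^sub>2 R\<^sub>0\<^sub>1 R\<^sub>1\<^sub>2) = R\<^sub>0\<^sub>1 Tr\<^sub>2 (C\<^sub>2 R\<^sub>1\<^sub>2) R\<^sub>0\<^sub>1 = R\<^sub>0\<^sub>1\<^sup>2 = I\<close>,
  so that both sides are \<open>Tr (Y) I\<close>.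
\<close>

lemma ptrace_C_R_conj:
  "(\<Sum>b\<in>UNIV. \<Sum>x\<in>UNIV. \<Sum>y\<in>UNIV. C $ b $ x * (R $ (a, x) $ (p, y) * R $ (q, y) $ (d, b))) =
     (if a = d then C $ q $ p else 0)"
proof (rule R_faithful[where v = p and u = q and G = "\<lambda>p q. if a = d then C $ q $ p else 0"
    and F = "\<lambda>p q. \<Sum>b\<in>UNIV. \<Sum>x\<in>UNIV. \<Sum>y\<in>UNIV. C $ b $ x * (R $ (a, x) $ (p, y) * R $ (q, y) $ (d, b))"])
  fix s t
  have "(\<Sum>p\<in>UNIV. \<Sum>q\<in>UNIV. (\<Sum>b\<in>UNIV. \<Sum>x\<in>UNIV. \<Sum>y\<in>UNIV. C $ b $ x * (R $ (a, x) $ (p, y) * R $ (q, y) $ (d, b))) * R $ (s, p) $ (t, q)) =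
    (\<Sum>p\<in>UNIV. \<Sum>q\<in>UNIV. \<Sum>b\<in>UNIV. \<Sum>x\<in>UNIV. \<Sum>y\<in>UNIV. C $ b $ x * (R $ (a, x) $ (p, y) * R $ (s, p) $ (t, q) * R $ (q, y) $ (d, b)))"
    by (simp add: sum_distrib_left sum_distrib_right mult_ac)
  also have "\<dots> = (\<Sum>b\<in>UNIV. \<Sum>x\<in>UNIV. \<Sum>p\<in>UNIV. \<Sum>y\<in>UNIV. \<Sum>q\<in>UNIV. C $ b $ x * (R $ (a, x) $ (p, y) * R $ (s, p) $ (t, q) * R $ (q, y) $ (d, b)))"
    by (simp only: sum.cartesian_product UNIV_Times_UNIV,
        rule sum.reindex_bij_witness[of _ "\<lambda>(b, x, p, y, q). (p, q, b, x, y)" "\<lambda>(p, q, b, x, y). (b, x, p, y, q)"]) auto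
  also have "\<dots> = (\<Sum>b\<in>UNIV. \<Sum>x\<in>UNIV. \<Sum>u\<in>UNIV. \<Sum>v\<in>UNIV. \<Sum>w\<in>UNIV. C $ b $ x * (R $ (s, a) $ (u, v) * R $ (v, x) $ (w, b) * R $ (u, w) $ (t, d)))"
    by (simp only: sum_distrib_left[symmetric] braid)
  also have "\<dots> = (\<Sum>u\<in>UNIV. \<Sum>v\<in>UNIV. \<Sum>w\<in>UNIV. \<Sum>b\<in>UNIV. \<Sum>x\<in>UNIV. (R $ (s, a) $ (u, v) * R $ (u, w) $ (t, d)) * (C $ b $ x * R $ (v, x) $ (w, b)))"
    by (simp only: sum.cartesian_product UNIV_Times_UNIV,
        rule sum.reindex_bij_witness[of _ "\<lambda>(u, v, w, b, x). (b, x, u, v, w)" "\<lambda>(b, x, u, v, w). (u, v, w, b, x)"]) auto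
  also have "\<dots> = (\<Sum>u\<in>UNIV. \<Sum>v\<in>UNIV. R $ (s, a) $ (u, v) * R $ (u, v) $ (t, d))"
    by (simp only: sum_distrib_left[symmetric] ptrace_C_R) (simp add: mult_if_zero)
  also have "\<dots> = (if s = t \<and> a = d then 1 else 0)"
    by (rule R_R_index)
  also have "\<dots> = (if a = d then (\<Sum>q\<in>UNIV. \<Sum>p\<in>UNIV. C $ q $ p * R $ (s, p) $ (t, q)) else 0)"
    by (simp add: ptrace_C_R)
  also have "\<dots> = (\<Sum>p\<in>UNIV. \<Sum>q\<in>UNIV. (if a = d then C $ q $ p else 0) * R $ (s, p) $ (t, q))"
    by (subst sum.swap) (simp add: mult_if_zero)
  finally show "(\<Sum>p\<in>UNIV. \<Sum>q\<in>UNIV. (\<Sum>b\<in>UNIV. \<Sum>x\<in>UNIV. \<Sum>y\<in>UNIV. C $ b $ x * (R $ (a, x) $ (p, y) * R $ (q, y) $ (d, b))) * R $ (s, p) $ (t, q)) =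
    (\<Sum>p\<in>UNIV. \<Sum>q\<in>UNIV. (if a = d then C $ q $ p else 0) * R $ (s, p) $ (t, q))" .
qed

text \<open>
  \<open>R\<^sub>2\<^sub>1 C\<^sub>1 = C\<^sub>2 \<Psi>\<close>: contracting \<open>ptrace_C_R_conj\<close> with \<open>\<Psi>\<close> removes the first of its two factors \<open>R\<close>.
\<close>

lemma R_C_eq_C_Psi:
  "(\<Sum>b\<in>UNIV. R $ (q, u) $ (d, b) * C $ b $ v) = (\<Sum>p\<in>UNIV. C $ q $ p * \<Psi> $ (u, p) $ (v, d))"
proof -
  have "(\<Sum>p\<in>UNIV. \<Sum>a\<in>UNIV. \<Psi> $ (u, p) $ (v, a) * (\<Sum>b\<in>UNIV. \<Sum>x\<in>UNIV. \<Sum>y\<in>UNIV. C $ b $ x * (R $ (a, x) $ (p, y) * R $ (q, y) $ (d, b)))) =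
     (\<Sum>p\<in>UNIV. \<Sum>a\<in>UNIV. \<Sum>b\<in>UNIV. \<Sum>x\<in>UNIV. \<Sum>y\<in>UNIV. (C $ b $ x * R $ (q, y) $ (d, b)) * (\<Psi> $ (u, p) $ (v, a) * R $ (a, x) $ (p, y)))"
    by (simp add: sum_distrib_left sum_distrib_right mult_ac)
  also have "\<dots> = (\<Sum>b\<in>UNIV. \<Sum>x\<in>UNIV. \<Sum>y\<in>UNIV. \<Sum>p\<in>UNIV. \<Sum>a\<in>UNIV. (C $ b $ x * R $ (q, y) $ (d, b)) * (\<Psi> $ (u, p) $ (v, a) * R $ (a, x) $ (p, y)))"
    by (simp only: sum.cartesian_product UNIV_Times_UNIV,
        rule sum.reindex_bij_witness[of _ "\<lambda>(b, x, y, p, a). (p, a, b, x, y)" "\<lambda>(p, a, b, x, y). (b, x, y, p, a)"]) auto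
  also have "\<dots> = (\<Sum>b\<in>UNIV. \<Sum>x\<in>UNIV. \<Sum>y\<in>UNIV. (C $ b $ x * R $ (q, y) $ (d, b)) * (if u = y \<and> x = v then 1 else 0))"
    by (simp only: sum_distrib_left[symmetric] Psi_R)
  also have "\<dots> = (\<Sum>b\<in>UNIV. \<Sum>x\<in>UNIV. if x = v then (\<Sum>y\<in>UNIV. if u = y then C $ b $ x * R $ (q, y) $ (d, b) else 0) else 0)"
    by (intro sum.cong refl) (auto simp: mult_if_zero)
  also have "\<dots> = (\<Sum>b\<in>UNIV. R $ (q, u) $ (d, b) * C $ b $ v)"
    by (simp add: mult.commute)
  finally show ?thesis
    by (simp add: ptrace_C_R_conj mult_if_zero) (simp add: mult.commute)
qed

end

lemma transpose_index: "transpose A $ i $ j = A $ j $ i"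
  by (simp add: transpose_def)

text \<open>
  The hypotheses are invariant under transposition.  This gives the mirror image
  \<open>C_R_eq_Psi_C\<close> of \<open>R_C_eq_C_Psi\<close> without a second computation.
\<close>

lemma skew_invertible_symmetry_transpose:
  assumes "skew_invertible_symmetry R \<Psi>"
  shows "skew_invertible_symmetry (transpose R) (transpose \<Psi>)"
proof -
  interpret skew_invertible_symmetry R \<Psi> by fact
  have on_T: "on_12 (transpose R) = transpose (on_12 R)" "on_23 (transpose R) = transpose (on_23 R)"
    by (auto simp: on_12_def on_23_def vec_eq_iff transpose_def)
  have "braiding (transpose R)"
    using symm unfolding involutive_symmetry_def braiding_def on_T
    by (simp add: matrix_transpose_mul[symmetric] matrix_mul_assoc)
  moreover have "transpose R ** transpose R = mat 1"
    by (simp add: matrix_transpose_mul[symmetric] R_R)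
  moreover have "skew_inverse (transpose R) (transpose \<Psi>)"
    unfolding skew_inverse_index transpose_index
  proof (intro conjI allI)
    fix a c d f
    show "(\<Sum>b\<in>UNIV. \<Sum>x\<in>UNIV. R $ (d, x) $ (a, b) * \<Psi> $ (b, f) $ (x, c)) = (if a = f \<and> c = d then 1 else 0)"
      by (subst sum.swap, subst R_Psi) auto
    show "(\<Sum>b\<in>UNIV. \<Sum>x\<in>UNIV. \<Psi> $ (d, x) $ (a, b) * R $ (b, f) $ (x, c)) = (if a = f \<and> c = d then 1 else 0)"
      by (subst sum.swap, subst Psi_R) auto
  qed
  ultimately show ?thesis
    by unfold_locales (simp_all add: involutive_symmetry_def)
qed

definition tensor_square :: "complex^'n::finite^'n \<Rightarrow> 'n op2" where
  "tensor_square M = (\<chi> I J. M $ fst I $ fst J * M $ snd I $ snd J)"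

context skew_invertible_symmetry
begin

lemma C_R_eq_Psi_C:
  "(\<Sum>b\<in>UNIV. C $ v $ b * R $ (d, b) $ (q, u)) = (\<Sum>p\<in>UNIV. \<Psi> $ (v, d) $ (u, p) * C $ p $ q)"
proof -
  interpret T: skew_invertible_symmetry "transpose R" "transpose \<Psi>"
    by (rule skew_invertible_symmetry_transpose) unfold_locales
  have "T.C = transpose C" by (simp add: C_op_def vec_eq_iff transpose_def)
  with T.R_C_eq_C_Psi[of q u d v] show ?thesis
    by (simp add: transpose_index mult.commute)
qed

text \<open>The two mirror identities combine to \<open>R\<^sub>2\<^sub>1 C\<^sub>1 C\<^sub>2 = C\<^sub>2 \<Psi> C\<^sub>2 = C\<^sub>2 C\<^sub>1 R\<^sub>2\<^sub>1\<close>.\<close>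

lemma R_commutes_C_C: "R ** tensor_square C = tensor_square C ** R"
proof -
  have "(R ** tensor_square C) $ (q, u) $ (w, v) = (tensor_square C ** R) $ (q, u) $ (w, v)" for q u w v
  proof -
    have "(R ** tensor_square C) $ (q, u) $ (w, v) = (\<Sum>d\<in>UNIV. (\<Sum>b\<in>UNIV. R $ (q, u) $ (d, b) * C $ b $ v) * C $ d $ w)"
      by (simp add: matrix_matrix_mult_def tensor_square_def sum_UNIV_prod sum_distrib_left sum_distrib_right mult_ac)
    also have "\<dots> = (\<Sum>d\<in>UNIV. \<Sum>p\<in>UNIV. C $ q $ p * (\<Psi> $ (u, p) $ (v, d) * C $ d $ w))"
      unfolding R_C_eq_C_Psi by (simp add: sum_distrib_left sum_distrib_right mult_ac)
    also have "\<dots> = (\<Sum>p\<in>UNIV. C $ q $ p * (\<Sum>d\<in>UNIV. \<Psi> $ (u, p) $ (v, d) * C $ d $ w))"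
      by (subst sum.swap) (simp add: sum_distrib_left)
    also have "\<dots> = (tensor_square C ** R) $ (q, u) $ (w, v)"
      unfolding C_R_eq_Psi_C[symmetric]
      by (simp add: matrix_matrix_mult_def tensor_square_def sum_UNIV_prod sum_distrib_left sum_distrib_right mult_ac)
    finally show ?thesis .
  qed
  then show ?thesis
    by (simp add: vec_eq_iff split_paired_all)
qed

end

section \<open>Equality in the algebra and in its tensor square\<close>

lemma scl_linear_span_subset:
  assumes "scl_linear f" "scl.subspace S" "\<And>x. x \<in> B \<Longrightarrow> f x \<in> S" "x \<in> scl.span B"
  shows "f x \<in> S"
  using assms(4)
proof (induction rule: scl.span_induct_alt)
  case base
  show ?case using assms(1,2) by (simp add: scl_linear_zero scl.subspace_0)
next
  case (step c x y)
  then show ?case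
    using assms(1-3) by (simp add: scl_linear_add scl_linear_scl scl.subspace_add scl.subspace_scale)
qed

lemma rel_ideal_subspace: "scl.subspace (rel_ideal R)"
  unfolding rel_ideal_def by simp

lemma rel_space2_subspace: "scl.subspace (rel_space2 R)"
  unfolding rel_space2_def by simp

lemma rel_ideal_mult_left: "x \<in> rel_ideal R \<Longrightarrow> a * x \<in> rel_ideal R"
  unfolding rel_ideal_def
proof (erule scl_linear_span_subset[OF mult_linear_right[of a] scl.subspace_span, rotated])
  fix y assume "y \<in> {a * x * b | a x b. x \<in> relators R}"
  then obtain c x b where y: "y = c * x * b" "x \<in> relators R" by blast
  then have "a * y = (a * c) * x * b" by (simp add: mult.assoc)
  with y show "a * y \<in> scl.span {a * x * b | a x b. x \<in> relators R}"
    by (intro scl.span_base) blast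
qed

lemma rel_ideal_mult_right: "x \<in> rel_ideal R \<Longrightarrow> x * a \<in> rel_ideal R"
  unfolding rel_ideal_def
proof (erule scl_linear_span_subset[OF mult_linear_left[of a] scl.subspace_span, rotated])
  fix y assume "y \<in> {a * x * b | a x b. x \<in> relators R}"
  then obtain c x b where y: "y = c * x * b" "x \<in> relators R" by blast
  then have "y * a = c * x * (b * a)" by (simp add: mult.assoc)
  with y show "y * a \<in> scl.span {a * x * b | a x b. x \<in> relators R}"
    by (intro scl.span_base) blast
qed

lemma rel_space2I: "a \<in> rel_ideal R \<or> b \<in> rel_ideal R \<Longrightarrow> a \<otimes> b \<in> rel_space2 R"
  unfolding rel_space2_def by (rule scl.span_base) auto

lemma rel_space2_linear_image:
  assumes "scl_linear f" "scl.subspace S"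
    and "\<And>a b. a \<in> rel_ideal R \<Longrightarrow> f (a \<otimes> b) \<in> S" "\<And>a b. b \<in> rel_ideal R \<Longrightarrow> f (a \<otimes> b) \<in> S"
    and "alg2_eq R s t"
  shows "f s - f t \<in> S"
proof -
  have "f (s - t) \<in> S"
    using assms(5) unfolding alg2_eq_def rel_space2_def
    by (rule scl_linear_span_subset[OF assms(1,2), rotated]) (use assms(3,4) in auto)
  then show ?thesis by (simp add: scl_linear_diff[OF assms(1)])
qed

lemma alg_eq_refl [simp]: "alg_eq R x x"
  by (simp add: alg_eq_def scl.subspace_0[OF rel_ideal_subspace])

lemma alg_eq_sym: "alg_eq R x y \<Longrightarrow> alg_eq R y x"
  unfolding alg_eq_def using scl.subspace_neg[OF rel_ideal_subspace] by fastforce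

lemma alg_eq_add: "alg_eq R x y \<Longrightarrow> alg_eq R x' y' \<Longrightarrow> alg_eq R (x + x') (y + y')"
  unfolding alg_eq_def using scl.subspace_add[OF rel_ideal_subspace]
  by (fastforce simp: add_diff_add)

lemma alg_eq_trans [trans]: "alg_eq R x y \<Longrightarrow> alg_eq R y z \<Longrightarrow> alg_eq R x z"
  unfolding alg_eq_def using scl.subspace_add[OF rel_ideal_subspace] by fastforce

lemma alg_eq_scl: "alg_eq R x y \<Longrightarrow> alg_eq R (scl c x) (scl c y)"
  unfolding alg_eq_def using scl.subspace_scale[OF rel_ideal_subspace]
  by (fastforce simp: scl.scale_right_diff_distrib[symmetric])

lemma alg_eq_uminus: "alg_eq R x y \<Longrightarrow> alg_eq R (- x) (- y)"
  unfolding alg_eq_def using scl.subspace_neg[OF rel_ideal_subspace] by fastforce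

lemma alg_eq_diff: "alg_eq R x y \<Longrightarrow> alg_eq R x' y' \<Longrightarrow> alg_eq R (x - x') (y - y')"
  using alg_eq_add[of R x y "- x'" "- y'"] by (simp add: alg_eq_uminus)

lemma alg_eq_mult: "alg_eq R x y \<Longrightarrow> alg_eq R x' y' \<Longrightarrow> alg_eq R (x * x') (y * y')"
proof -
  assume "alg_eq R x y" "alg_eq R x' y'"
  then have "(x - y) * x' \<in> rel_ideal R" "y * (x' - y') \<in> rel_ideal R"
    by (simp_all add: alg_eq_def rel_ideal_mult_left rel_ideal_mult_right)
  from scl.subspace_add[OF rel_ideal_subspace this] show ?thesis
    by (simp add: alg_eq_def algebra_simps)
qed

lemma alg_eq_sum: "(\<And>i. i \<in> I \<Longrightarrow> alg_eq R (f i) (g i)) \<Longrightarrow> alg_eq R (sum f I) (sum g I)"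
  unfolding alg_eq_def sum_subtractf[symmetric] by (rule scl.subspace_sum[OF rel_ideal_subspace])

lemma alg2_eq_trans [trans]: "alg2_eq R x y \<Longrightarrow> alg2_eq R y z \<Longrightarrow> alg2_eq R x z"
  unfolding alg2_eq_def using scl.subspace_add[OF rel_space2_subspace] by fastforce

lemma alg2_eq_refl [simp]: "alg2_eq R x x"
  by (simp add: alg2_eq_def scl.subspace_0[OF rel_space2_subspace])

lemma alg2_eq_sum: "(\<And>i. i \<in> I \<Longrightarrow> alg2_eq R (f i) (g i)) \<Longrightarrow> alg2_eq R (sum f I) (sum g I)"
  unfolding alg2_eq_def sum_subtractf[symmetric] by (rule scl.subspace_sum[OF rel_space2_subspace])

definition mat_eq :: "'n::finite op2 \<Rightarrow> 'n falg ^ 'b ^ 'a \<Rightarrow> 'n falg ^ 'b ^ 'a \<Rightarrow> bool" where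
  "mat_eq R M N \<longleftrightarrow> (\<forall>i j. alg_eq R (M $ i $ j) (N $ i $ j))"

definition mat2_eq :: "'n::finite op2 \<Rightarrow> 'n falg2 ^ 'b ^ 'a \<Rightarrow> 'n falg2 ^ 'b ^ 'a \<Rightarrow> bool" where
  "mat2_eq R M N \<longleftrightarrow> (\<forall>i j. alg2_eq R (M $ i $ j) (N $ i $ j))"

lemma mat_eq_refl [simp]: "mat_eq R M M"
  by (simp add: mat_eq_def)

lemma mat_eq_sym: "mat_eq R M N \<Longrightarrow> mat_eq R N M"
  by (auto simp: mat_eq_def alg_eq_sym)

lemma mat_eq_trans [trans]: "mat_eq R M N \<Longrightarrow> mat_eq R N K \<Longrightarrow> mat_eq R M K"
  unfolding mat_eq_def using alg_eq_trans by blast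

lemma mat_eq_diff: "mat_eq R M N \<Longrightarrow> mat_eq R M' N' \<Longrightarrow> mat_eq R (M - M') (N - N')"
  by (simp add: mat_eq_def alg_eq_diff)

lemma mat_eq_mult: "mat_eq R M N \<Longrightarrow> mat_eq R M' N' \<Longrightarrow> mat_eq R (M ** M') (N ** N')"
  by (simp add: mat_eq_def matrix_matrix_mult_def alg_eq_sum alg_eq_mult)

section \<open>Brackets of matrices over the algebra\<close>

definition bracket_mat :: "('n falg2 \<Rightarrow> 'n falg) \<Rightarrow> 'n falg ^ 'b::finite ^ 'a \<Rightarrow> 'n falg ^ 'c ^ 'b \<Rightarrow> 'n falg ^ 'c ^ 'a" where
  "bracket_mat br A B = map_mat br (A \<odot> B)"

definition smat :: "complex \<Rightarrow> ('k::monoid_add \<Rightarrow>\<^sub>0 complex) ^ 'b ^ 'a \<Rightarrow> ('k \<Rightarrow>\<^sub>0 complex) ^ 'b ^ 'a" where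
  "smat c M = map_mat (scl c) M"

lemma Q_12_tens: "scl_linear Q \<Longrightarrow> Q_12 Q (a \<otimes> b \<otimes> c) = assoc_r (Q (a \<otimes> b) \<otimes> c)"
  by (simp add: Q_12_def assoc_l_tens map_tens_tens scl_linear_id)

lemma Q_23_tens: "scl_linear Q \<Longrightarrow> Q_23 Q (a \<otimes> s) = a \<otimes> Q s"
  by (simp add: Q_23_def map_tens_tens scl_linear_id)

lemma map_mat_linear_mult_const:
  assumes "scl_linear f"
  shows "map_mat f (M ** const_mat N) = map_mat f M ** const_mat N"
    and "map_mat f (const_mat N ** M) = const_mat N ** map_mat f M"
proof -
  show "map_mat f (M ** const_mat N) = map_mat f M ** const_mat N"
    by (simp add: vec_eq_iff map_mat_def matrix_matrix_mult_def const_mat_def mult_single_zero scl_linear_sum[OF assms] scl_linear_scl[OF assms])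
  show "map_mat f (const_mat N ** M) = const_mat N ** map_mat f M"
    by (simp add: vec_eq_iff map_mat_def matrix_matrix_mult_def const_mat_def scl_def[symmetric] scl_linear_sum[OF assms] scl_linear_scl[OF assms])
qed

text \<open>
  Matrices with constant entries can be moved freely through \<open>\<odot>\<close>.  In this way \<open>R\<close> is taken out
  of brackets of \<open>bar2 R B = R B\<^sub>1 R\<close>.
\<close>

lemma odot_const_left: "(const_mat N ** A) \<odot> B = const_mat N ** (A \<odot> B)"
  by (simp add: vec_eq_iff odot_def matrix_matrix_mult_def const_mat_def scl_def[symmetric] tens_sum_left
       tens_scl_left scl.scale_sum_right) (subst sum.swap, simp)

lemma odot_const_right: "A \<odot> (B ** const_mat N) = (A \<odot> B) ** const_mat N"
  by (simp add: vec_eq_iff odot_def matrix_matrix_mult_def const_mat_def mult_single_zero tens_sum_right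
       tens_scl_right scl.scale_sum_right) (subst sum.swap, simp)

lemma odot_const_middle: "(A ** const_mat N) \<odot> B = A \<odot> (const_mat N ** B)"
  by (simp add: vec_eq_iff odot_def matrix_matrix_mult_def const_mat_def mult_single_zero scl_def[symmetric]
       tens_sum_right tens_scl_right tens_sum_left tens_scl_left) (subst sum.swap, simp)

lemma bracket_mat_const:
  assumes "scl_linear br"
  shows "bracket_mat br (const_mat N ** A) B = const_mat N ** bracket_mat br A B"
    and "bracket_mat br A (B ** const_mat N) = bracket_mat br A B ** const_mat N"
    and "bracket_mat br (A ** const_mat N) B = bracket_mat br A (const_mat N ** B)"
  by (simp_all add: bracket_mat_def odot_const_left odot_const_right odot_const_middle
        map_mat_linear_mult_const[OF assms])

lemma linear_alg2_eq_cong: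
  assumes "scl_linear f"
    and "\<And>a b. a \<in> rel_ideal R \<Longrightarrow> f (a \<otimes> b) \<in> rel_ideal R" "\<And>a b. b \<in> rel_ideal R \<Longrightarrow> f (a \<otimes> b) \<in> rel_ideal R"
    and "alg2_eq R s t"
  shows "alg_eq R (f s) (f t)"
  unfolding alg_eq_def by (rule rel_space2_linear_image[OF assms(1) rel_ideal_subspace assms(2-4)])

locale braided_algebra =
  fixes R :: "'n::finite op2" and Q :: "'n falg2 \<Rightarrow> 'n falg2"
  assumes braiding_Q: "algebra_braiding R Q"
begin

lemma
  shows Q_linear: "scl_linear Q"
    and Q_cong: "alg2_eq R s t \<Longrightarrow> alg2_eq R (Q s) (Q t)"
    and Q_gen: "mat2_eq R (map_mat Q (bar1 (L_mat k) \<odot> bar2 R (L_mat l))) (bar2 R (L_mat l) \<odot> bar1 (L_mat k))"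
    and Q_one_left: "alg2_eq R (Q (1 \<otimes> a)) (a \<otimes> 1)"
    and Q_one_right: "alg2_eq R (Q (a \<otimes> 1)) (1 \<otimes> a)"
    and Q_mult_left: "alg2_eq R (Q ((a * b) \<otimes> c)) (map_tens id mu (Q_12 Q (Q_23 Q (a \<otimes> b \<otimes> c))))"
  using braiding_Q unfolding algebra_braiding_def mat2_eq_def by blast+

lemma Q_rel_space2: "s \<in> rel_space2 R \<Longrightarrow> Q s \<in> rel_space2 R"
  using Q_cong[of s 0] by (simp add: alg2_eq_def scl_linear_zero[OF Q_linear])

text \<open>
  The defining property of \<open>Q\<close> on generators, \<open>A = L\<^sup>(\<^sup>k\<^sup>)\<^sub>1\<close> and \<open>B = L\<^sup>(\<^sup>l\<^sup>)\<^sub>2'\<close>, for arbitrary matrices.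
  It is inherited by products, and it reduces the braided Leibniz rule to the ordinary one.
\<close>

definition passes :: "'n falg ^ 'a::finite ^ 'a \<Rightarrow> 'n falg ^ 'a ^ 'a \<Rightarrow> bool" where
  "passes A B \<longleftrightarrow> mat2_eq R (map_mat Q (A \<odot> B)) (B \<odot> A)"

lemma map_mat_Q_odot: "map_mat Q (A \<odot> B) $ i $ j = (\<Sum>k\<in>UNIV. Q ((A $ i $ k) \<otimes> (B $ k $ j)))"
  by (simp add: map_mat_def odot_def scl_linear_sum[OF Q_linear])

lemma passes_one: "passes (mat 1) B"
proof -
  have "map_mat Q (mat 1 \<odot> B) $ i $ j = Q (1 \<otimes> (B $ i $ j))" for i j
  proof -
    have "map_mat Q (mat 1 \<odot> B) $ i $ j = (\<Sum>k\<in>UNIV. if i = k then Q (1 \<otimes> (B $ k $ j)) else 0)"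
      unfolding map_mat_Q_odot by (intro sum.cong) (auto simp: mat_def scl_linear_zero[OF Q_linear])
    then show ?thesis by simp
  qed
  moreover have "(B \<odot> mat 1) $ i $ j = (B $ i $ j) \<otimes> 1" for i j
  proof -
    have "(B \<odot> mat 1) $ i $ j = (\<Sum>k\<in>UNIV. if k = j then (B $ i $ k) \<otimes> 1 else 0)"
      unfolding odot_def vec_lambda_beta by (intro sum.cong) (auto simp: mat_def)
    then show ?thesis by simp
  qed
  ultimately show ?thesis
    by (simp add: passes_def mat2_eq_def Q_one_left)
qed

lemma passes_one_right: "passes A (mat 1)"
proof -
  have "map_mat Q (A \<odot> mat 1) $ i $ j = Q ((A $ i $ j) \<otimes> 1)" for i j
  proof -
    have "map_mat Q (A \<odot> mat 1) $ i $ j = (\<Sum>k\<in>UNIV. if k = j then Q ((A $ i $ k) \<otimes> 1) else 0)"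
      unfolding map_mat_Q_odot by (intro sum.cong) (auto simp: mat_def scl_linear_zero[OF Q_linear])
    then show ?thesis by simp
  qed
  moreover have "(mat 1 \<odot> A) $ i $ j = 1 \<otimes> (A $ i $ j)" for i j
  proof -
    have "(mat 1 \<odot> A) $ i $ j = (\<Sum>k\<in>UNIV. if i = k then 1 \<otimes> (A $ k $ j) else 0)"
      unfolding odot_def vec_lambda_beta by (intro sum.cong) (auto simp: mat_def)
    then show ?thesis by simp
  qed
  ultimately show ?thesis
    by (simp add: passes_def mat2_eq_def Q_one_right)
qed

definition rmult_snd :: "'n falg2 \<Rightarrow> 'n falg \<Rightarrow> 'n falg2" where
  "rmult_snd s y = map_tens id mu (assoc_r (s \<otimes> y))"

lemma rmult_snd_linear: "scl_linear (\<lambda>s. rmult_snd s y)"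
  unfolding rmult_snd_def
  by (rule scl_linear_compose[OF scl_linear_compose[OF tens_linear_left assoc_r_linear] map_tens_linear])

lemma rmult_snd_tens: "rmult_snd (x \<otimes> z) y = x \<otimes> (z * y)"
  by (simp add: rmult_snd_def assoc_r_tens map_tens_tens scl_linear_id mu_linear mu_tens)

lemma rmult_snd_cong: "alg2_eq R s t \<Longrightarrow> alg2_eq R (rmult_snd s y) (rmult_snd t y)"
  unfolding alg2_eq_def[of R "rmult_snd s y"]
  by (rule rel_space2_linear_image[OF rmult_snd_linear rel_space2_subspace])
     (auto simp: rmult_snd_tens intro!: rel_space2I rel_ideal_mult_right)

lemma rmult_snd_rel_ideal:
  assumes "y \<in> rel_ideal R" shows "rmult_snd s y \<in> rel_space2 R"
proof -
  have "s \<in> scl.span (range (\<lambda>k. Poly_Mapping.single k 1))"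
  proof -
    have "(\<Sum>k\<in>Poly_Mapping.keys s. scl (Poly_Mapping.lookup s k) (Poly_Mapping.single k 1)) \<in> scl.span (range (\<lambda>k. Poly_Mapping.single k 1))"
      by (intro scl.span_sum scl.span_scale scl.span_base) auto
    then show ?thesis
      by (simp add: scl_single poly_mapping_sum_single[symmetric])
  qed
  then show ?thesis
  proof (rule scl_linear_span_subset[OF rmult_snd_linear rel_space2_subspace, rotated])
    fix x :: "'n falg2" assume "x \<in> range (\<lambda>k. Poly_Mapping.single k 1)"
    then obtain u v where "x = Poly_Mapping.single u 1 \<otimes> Poly_Mapping.single v 1"
      by (auto simp: tens_single)
    then show "rmult_snd x y \<in> rel_space2 R"
      using assms by (auto simp: rmult_snd_tens intro!: rel_space2I rel_ideal_mult_left)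
  qed
qed

text \<open>
  The formula for \<open>Q (a b \<otimes> c)\<close> is \<open>braid_past a\<close> applied to \<open>Q (b \<otimes> c)\<close>.  As a map of its second
  argument \<open>braid_past a\<close> descends to \<open>\<A> \<otimes> \<A>\<close>, so the value of \<open>Q\<close> on \<open>b \<otimes> c\<close> may be
  replaced by a congruent one.
\<close>

definition braid_past :: "'n falg \<Rightarrow> 'n falg2 \<Rightarrow> 'n falg2" where
  "braid_past a t = map_tens id mu (Q_12 Q (a \<otimes> t))"

lemma braid_past_linear: "scl_linear (braid_past a)"
proof -
  have "scl_linear (Q_12 Q)"
    unfolding Q_12_def[abs_def]
    by (rule scl_linear_compose[OF scl_linear_compose[OF assoc_l_linear map_tens_linear] assoc_r_linear])
  then show ?thesis
    unfolding braid_past_def[abs_def]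
    by (intro scl_linear_compose[OF scl_linear_compose[OF tens_linear_right] map_tens_linear])
qed

lemma braid_past_tens: "braid_past a (x \<otimes> y) = rmult_snd (Q (a \<otimes> x)) y"
  by (simp add: braid_past_def Q_12_tens[OF Q_linear] rmult_snd_def)

lemma braid_past_cong: "alg2_eq R s t \<Longrightarrow> alg2_eq R (braid_past a s) (braid_past a t)"
  unfolding alg2_eq_def[of R "braid_past a s"]
proof (rule rel_space2_linear_image[OF braid_past_linear rel_space2_subspace])
  fix x y assume "x \<in> rel_ideal R"
  then have "alg2_eq R (Q (a \<otimes> x)) 0"
    by (simp add: alg2_eq_def Q_rel_space2 rel_space2I)
  from rmult_snd_cong[OF this] show "braid_past a (x \<otimes> y) \<in> rel_space2 R"
    by (simp add: braid_past_tens alg2_eq_def scl_linear_zero[OF rmult_snd_linear])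
qed (auto simp: braid_past_tens rmult_snd_rel_ideal)

text \<open>
  First \<open>A'\<close>, then \<open>A\<close> is moved past \<open>B\<close>.  Each move is a congruence only after summation over a
  matrix index, hence the sums are regrouped between the two moves.
\<close>

lemma passes_mult_left:
  assumes "passes A B" "passes A' B"
  shows "passes (A ** A') B"
  unfolding passes_def mat2_eq_def
proof (intro allI)
  fix i j
  have "map_mat Q ((A ** A') \<odot> B) $ i $ j = (\<Sum>k\<in>UNIV. \<Sum>m\<in>UNIV. Q ((A $ i $ k * A' $ k $ m) \<otimes> (B $ m $ j)))"
    unfolding map_mat_Q_odot matrix_matrix_mult_def
    by (simp add: tens_sum_left scl_linear_sum[OF Q_linear]) (rule sum.swap)
  also have "alg2_eq R \<dots> (\<Sum>k\<in>UNIV. \<Sum>m\<in>UNIV. braid_past (A $ i $ k) (Q ((A' $ k $ m) \<otimes> (B $ m $ j))))"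
    using Q_mult_left by (intro alg2_eq_sum) (simp add: braid_past_def Q_23_tens[OF Q_linear])
  also have "\<dots> = (\<Sum>k\<in>UNIV. braid_past (A $ i $ k) (map_mat Q (A' \<odot> B) $ k $ j))"
    by (simp add: map_mat_Q_odot scl_linear_sum[OF braid_past_linear])
  also have "alg2_eq R \<dots> (\<Sum>k\<in>UNIV. braid_past (A $ i $ k) ((B \<odot> A') $ k $ j))"
    using assms(2) by (intro alg2_eq_sum braid_past_cong) (simp add: passes_def mat2_eq_def)
  also have "\<dots> = (\<Sum>m\<in>UNIV. rmult_snd (map_mat Q (A \<odot> B) $ i $ m) (A' $ m $ j))"
    unfolding map_mat_Q_odot
    by (simp add: odot_def scl_linear_sum[OF braid_past_linear] scl_linear_sum[OF rmult_snd_linear] braid_past_tens)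
       (rule sum.swap)
  also have "alg2_eq R \<dots> (\<Sum>m\<in>UNIV. rmult_snd ((B \<odot> A) $ i $ m) (A' $ m $ j))"
    using assms(1) by (intro alg2_eq_sum rmult_snd_cong) (simp add: passes_def mat2_eq_def)
  also have "\<dots> = (B \<odot> (A ** A')) $ i $ j"
    by (simp add: odot_def matrix_matrix_mult_def scl_linear_sum[OF rmult_snd_linear] rmult_snd_tens tens_sum_right)
       (rule sum.swap)
  finally show "alg2_eq R (map_mat Q ((A ** A') \<odot> B) $ i $ j) ((B \<odot> (A ** A')) $ i $ j)" .
qed

end

locale braided_poisson_algebra = braided_algebra R Q for R :: "'n::finite op2" and Q +
  fixes r :: nat and br
  assumes bracket_br: "braided_bracket R r Q br"
begin

lemma
  shows br_linear: "scl_linear br"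
    and br_cong: "alg2_eq R s t \<Longrightarrow> alg_eq R (br s) (br t)"
    and br_gen: "mat_eq R (bracket_mat br (bar1 (L_mat k)) (bar2 R (L_mat l)))
        (smat (alpha r k l) (bar1 (L_mat (k + l + r)) ** const_mat R - const_mat R ** bar1 (L_mat (k + l + r))))"
    and br_leibniz: "alg_eq R (br (a \<otimes> (b * c))) (br (a \<otimes> b) * c + mu (map_tens id br (Q_12 Q (a \<otimes> b \<otimes> c))))"
    and br_skew: "alg_eq R (br (a \<otimes> b)) (- br (Q (a \<otimes> b)))"
  using bracket_br unfolding braided_bracket_def bracket_mat_def mat_eq_def smat_def
  by (blast | simp add: map_mat_def)+

lemma br_rel_space2: "s \<in> rel_space2 R \<Longrightarrow> br s \<in> rel_ideal R"
  using br_cong[of s 0] by (simp add: alg2_eq_def alg_eq_def scl_linear_zero[OF br_linear])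

lemma bracket_mat_index: "bracket_mat br A B $ i $ j = (\<Sum>k\<in>UNIV. br ((A $ i $ k) \<otimes> (B $ k $ j)))"
  by (simp add: bracket_mat_def map_mat_def odot_def scl_linear_sum[OF br_linear])

text \<open>
  The second summand of the Leibniz rule for \<open>br (a \<otimes> (b * c))\<close> is \<open>leib c\<close> at \<open>Q (a \<otimes> b)\<close>.
\<close>

definition leib :: "'n falg \<Rightarrow> 'n falg2 \<Rightarrow> 'n falg" where
  "leib c s = mu (map_tens id br (assoc_r (s \<otimes> c)))"

lemma leib_linear: "scl_linear (leib c)"
  unfolding leib_def[abs_def]
  by (rule scl_linear_compose[OF scl_linear_compose[OF scl_linear_compose[OF tens_linear_left assoc_r_linear]
        map_tens_linear] mu_linear])

lemma leib_tens: "leib c (x \<otimes> y) = x * br (y \<otimes> c)"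
  by (simp add: leib_def assoc_r_tens map_tens_tens scl_linear_id br_linear mu_tens)

lemma leib_cong: "alg2_eq R s t \<Longrightarrow> alg_eq R (leib c s) (leib c t)"
  by (rule linear_alg2_eq_cong[OF leib_linear])
     (auto simp: leib_tens intro: rel_ideal_mult_left rel_ideal_mult_right br_rel_space2 rel_space2I)

lemma bracket_mat_leibniz:
  assumes "passes A B"
  shows "mat_eq R (bracket_mat br A (B ** D)) (bracket_mat br A B ** D + B ** bracket_mat br A D)"
  unfolding mat_eq_def
proof (intro allI)
  fix i j
  have "bracket_mat br A (B ** D) $ i $ j = (\<Sum>k\<in>UNIV. \<Sum>m\<in>UNIV. br ((A $ i $ k) \<otimes> (B $ k $ m * D $ m $ j)))"
    unfolding bracket_mat_index matrix_matrix_mult_def by (simp add: tens_sum_right scl_linear_sum[OF br_linear])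
  also have "alg_eq R \<dots> (\<Sum>k\<in>UNIV. \<Sum>m\<in>UNIV. br ((A $ i $ k) \<otimes> (B $ k $ m)) * D $ m $ j
      + leib (D $ m $ j) (Q ((A $ i $ k) \<otimes> (B $ k $ m))))"
    using br_leibniz by (intro alg_eq_sum) (simp add: leib_def Q_12_tens[OF Q_linear])
  also have "\<dots> = (\<Sum>k\<in>UNIV. \<Sum>m\<in>UNIV. br ((A $ i $ k) \<otimes> (B $ k $ m)) * D $ m $ j)
      + (\<Sum>k\<in>UNIV. \<Sum>m\<in>UNIV. leib (D $ m $ j) (Q ((A $ i $ k) \<otimes> (B $ k $ m))))"
    by (simp add: sum.distrib)
  also have "(\<Sum>k\<in>UNIV. \<Sum>m\<in>UNIV. br ((A $ i $ k) \<otimes> (B $ k $ m)) * D $ m $ j) = (bracket_mat br A B ** D) $ i $ j"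
    by (simp add: matrix_matrix_mult_def bracket_mat_index sum_distrib_right) (rule sum.swap)
  also have "(\<Sum>k\<in>UNIV. \<Sum>m\<in>UNIV. leib (D $ m $ j) (Q ((A $ i $ k) \<otimes> (B $ k $ m)))) =
      (\<Sum>m\<in>UNIV. leib (D $ m $ j) (map_mat Q (A \<odot> B) $ i $ m))"
    by (simp add: map_mat_Q_odot scl_linear_sum[OF leib_linear]) (rule sum.swap)
  also have "alg_eq R ((bracket_mat br A B ** D) $ i $ j + \<dots>)
      ((bracket_mat br A B ** D) $ i $ j + (\<Sum>m\<in>UNIV. leib (D $ m $ j) ((B \<odot> A) $ i $ m)))"
    using assms by (intro alg_eq_add alg_eq_refl alg_eq_sum leib_cong) (simp add: passes_def mat2_eq_def)
  also have "(\<Sum>m\<in>UNIV. leib (D $ m $ j) ((B \<odot> A) $ i $ m)) = (B ** bracket_mat br A D) $ i $ j"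
    by (simp add: odot_def matrix_matrix_mult_def bracket_mat_index scl_linear_sum[OF leib_linear] leib_tens sum_distrib_left)
       (rule sum.swap)
  finally show "alg_eq R (bracket_mat br A (B ** D) $ i $ j) ((bracket_mat br A B ** D + B ** bracket_mat br A D) $ i $ j)"
    by simp
qed

lemma bracket_mat_skew:
  assumes "passes A B"
  shows "mat_eq R (bracket_mat br A B) (- bracket_mat br B A)"
  unfolding mat_eq_def
proof (intro allI)
  fix i j
  have "alg_eq R (bracket_mat br A B $ i $ j) (\<Sum>k\<in>UNIV. - br (Q ((A $ i $ k) \<otimes> (B $ k $ j))))"
    unfolding bracket_mat_index by (intro alg_eq_sum br_skew)
  also have "\<dots> = - br (map_mat Q (A \<odot> B) $ i $ j)"
    by (simp add: map_mat_Q_odot scl_linear_sum[OF br_linear] sum_negf)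
  also have "alg_eq R \<dots> (- br ((B \<odot> A) $ i $ j))"
    using assms by (intro alg_eq_uminus br_cong) (simp add: passes_def mat2_eq_def)
  finally show "alg_eq R (bracket_mat br A B $ i $ j) ((- bracket_mat br B A) $ i $ j)"
    by (simp add: bracket_mat_def map_mat_def)
qed

text \<open>The Leibniz rule for \<open>1 = 1 \<cdot> 1\<close> says that the bracket with \<open>1\<close> is twice itself.\<close>

lemma bracket_mat_one:
  fixes A :: "'n falg ^ 'a::finite ^ 'a"
  shows "mat_eq R (bracket_mat br A (mat 1)) 0"
proof -
  have "mat_eq R (bracket_mat br A (mat 1)) (bracket_mat br A (mat 1) + bracket_mat br A (mat 1))"
    using bracket_mat_leibniz[OF passes_one_right, of A "mat 1"] by simp
  from mat_eq_diff[OF this mat_eq_refl[of _ "bracket_mat br A (mat 1)"]]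
  show ?thesis by (simp add: mat_eq_sym)
qed

end

section \<open>Products of generating matrices and R-traces\<close>

lemma const_mat_mult: "const_mat (M ** N) = (const_mat M ** const_mat N :: ('k::monoid_add \<Rightarrow>\<^sub>0 complex)^'c^'a)"
proof -
  have "Poly_Mapping.single 0 (sum f S) = (\<Sum>k\<in>S. Poly_Mapping.single 0 (f k) :: 'k \<Rightarrow>\<^sub>0 complex)" for f :: "'b \<Rightarrow> complex" and S
    by (induction S rule: infinite_finite_induct) (simp_all add: single_add)
  then show ?thesis
    by (simp add: vec_eq_iff const_mat_def matrix_matrix_mult_def mult_single)
qed

lemma const_mat_one: "const_mat (mat 1) = (mat 1 :: ('k::monoid_add \<Rightarrow>\<^sub>0 complex)^'a^'a)"
  by (simp add: vec_eq_iff const_mat_def mat_def)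

lemma trace_const_mat: "trace (const_mat N ** M) = (\<Sum>i\<in>UNIV. \<Sum>j\<in>UNIV. scl (N $ i $ j) (M $ j $ i))"
  by (simp add: trace_def matrix_matrix_mult_def const_mat_def scl_def)

lemma trace_const_mat_commute: "trace (const_mat N ** M) = trace (M ** const_mat N)"
proof -
  have "trace (M ** const_mat N) = (\<Sum>j\<in>UNIV. \<Sum>i\<in>UNIV. scl (N $ i $ j) (M $ j $ i))"
    by (simp add: trace_def matrix_matrix_mult_def const_mat_def mult_single_zero)
  also have "\<dots> = trace (const_mat N ** M)"
    unfolding trace_const_mat by (rule sum.swap)
  finally show ?thesis ..
qed

lemma bar1_mult: "bar1 (M ** N) = bar1 M ** bar1 N"
  by (auto simp: vec_eq_iff bar1_def matrix_matrix_mult_def sum_UNIV_prod mult_if_zero sum_if_const)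

lemma bar1_one: "bar1 (mat 1) = mat 1"
  by (auto simp: vec_eq_iff bar1_def mat_def prod_eq_iff)

inductive_set monomials :: "('n::finite falg ^ 'n ^ 'n) set" where
  one: "mat 1 \<in> monomials"
| step: "M \<in> monomials \<Longrightarrow> L_mat k ** M \<in> monomials"

lemma L_mat_monomial: "L_mat k \<in> monomials"
  using monomials.step[OF monomials.one, of k] by simp

lemma monomials_mult: "M \<in> monomials \<Longrightarrow> N \<in> monomials \<Longrightarrow> M ** N \<in> monomials"
  by (induction rule: monomials.induct) (auto simp: matrix_mul_assoc[symmetric] intro: monomials.step)

lemma mpow_0: "mpow M 0 = mat 1" and mpow_Suc: "mpow M (Suc k) = M ** mpow M k"
  by (simp_all add: mpow_def)

lemma mpow_add: "mpow M (a + b) = mpow M a ** mpow M b"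
  by (induction a) (simp_all add: mpow_0 mpow_Suc matrix_mul_assoc)

lemma mpow_monomial: "M \<in> monomials \<Longrightarrow> mpow M k \<in> monomials"
  by (induction k) (auto simp: mpow_0 mpow_Suc intro: monomials.one monomials_mult)

context skew_invertible_symmetry
begin

abbreviation RR :: "'n falg ^ ('n \<times> 'n) ^ ('n \<times> 'n)" where "RR \<equiv> const_mat R"

lemma RR_RR: "RR ** RR = mat 1" "X ** RR ** RR = X"
proof -
  show "RR ** RR = mat 1"
    by (simp add: const_mat_mult[symmetric] R_R const_mat_one)
  then show "X ** RR ** RR = X"
    by (simp add: matrix_mul_assoc[symmetric])
qed

lemma bar2_eq: "bar2 R M = RR ** bar1 M ** RR"
  by (simp add: bar2_def matrix_inv_R)

lemma bar2_mult: "bar2 R (M ** N) = bar2 R M ** bar2 R N"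
  by (simp add: bar2_eq bar1_mult matrix_mul_assoc RR_RR)

lemma bar2_one: "bar2 R (mat 1) = mat 1"
  by (simp add: bar2_eq bar1_one RR_RR)

text \<open>
  Used as rewrite rules, these move \<open>R\<close> to the right end of a product, interchanging the two bars;
  the versions with \<open>X\<close> apply inside products associated to the left.
\<close>

lemma RR_bar: "RR ** bar1 M = bar2 R M ** RR" "RR ** bar2 R M = bar1 M ** RR"
    "X ** RR ** bar1 M = X ** bar2 R M ** RR" "X ** RR ** bar2 R M = X ** bar1 M ** RR"
proof -
  show *: "RR ** bar1 M = bar2 R M ** RR" "RR ** bar2 R M = bar1 M ** RR"
    by (simp_all add: bar2_eq matrix_mul_assoc RR_RR)
  show "X ** RR ** bar1 M = X ** bar2 R M ** RR" "X ** RR ** bar2 R M = X ** bar1 M ** RR"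
    by (simp_all add: matrix_mul_assoc[symmetric] *)
qed

lemma bars_commute_left:
  assumes "mat_eq R (bar1 A ** bar2 R B) (bar2 R B ** bar1 A)" "mat_eq R (bar1 A' ** bar2 R B) (bar2 R B ** bar1 A')"
  shows "mat_eq R (bar1 (A ** A') ** bar2 R B) (bar2 R B ** bar1 (A ** A'))"
proof -
  have "mat_eq R (bar1 A ** (bar1 A' ** bar2 R B)) (bar1 A ** (bar2 R B ** bar1 A'))"
    by (intro mat_eq_mult mat_eq_refl assms)
  also have "\<dots> = (bar1 A ** bar2 R B) ** bar1 A'" by (simp add: matrix_mul_assoc)
  also have "mat_eq R \<dots> (bar2 R B ** bar1 A ** bar1 A')"
    by (intro mat_eq_mult mat_eq_refl assms)
  finally show ?thesis by (simp add: bar1_mult matrix_mul_assoc)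
qed

lemma bars_commute_right:
  assumes "mat_eq R (bar1 A ** bar2 R B) (bar2 R B ** bar1 A)" "mat_eq R (bar1 A ** bar2 R B') (bar2 R B' ** bar1 A)"
  shows "mat_eq R (bar1 A ** bar2 R (B ** B')) (bar2 R (B ** B') ** bar1 A)"
proof -
  have "mat_eq R (bar1 A ** bar2 R B ** bar2 R B') (bar2 R B ** bar1 A ** bar2 R B')"
    by (intro mat_eq_mult mat_eq_refl assms)
  also have "\<dots> = bar2 R B ** (bar1 A ** bar2 R B')" by (simp add: matrix_mul_assoc)
  also have "mat_eq R \<dots> (bar2 R B ** (bar2 R B' ** bar1 A))"
    by (intro mat_eq_mult mat_eq_refl assms)
  finally show ?thesis by (simp add: bar2_mult matrix_mul_assoc)
qed

lemma generators_commute: "mat_eq R (bar1 (L_mat k) ** bar2 R (L_mat l)) (bar2 R (L_mat l) ** bar1 (L_mat k))"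
proof -
  have "(bar1 (L_mat k) ** bar2 R (L_mat l) - bar2 R (L_mat l) ** bar1 (L_mat k)) $ I $ J \<in> rel_ideal R" for I J
  proof -
    let ?x = "(bar1 (L_mat k) ** bar2 R (L_mat l) - bar2 R (L_mat l) ** bar1 (L_mat k)) $ I $ J"
    have "?x \<in> relators R" unfolding relators_def by blast
    then have "1 * ?x * 1 \<in> rel_ideal R"
      unfolding rel_ideal_def by (intro scl.span_base) blast
    then show ?thesis by simp
  qed
  then show ?thesis by (simp add: mat_eq_def alg_eq_def)
qed

lemma monomials_commute:
  assumes "A \<in> monomials" "B \<in> monomials"
  shows "mat_eq R (bar1 A ** bar2 R B) (bar2 R B ** bar1 A)"
proof -
  have *: "mat_eq R (bar1 (L_mat k) ** bar2 R B) (bar2 R B ** bar1 (L_mat k))" for k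
    using assms(2)
    by induction (simp_all add: bar2_one bars_commute_right generators_commute)
  show ?thesis
    using assms(1) by induction (simp_all add: bar1_one bars_commute_left *)
qed

definition Rtrace2 :: "'n falg ^ ('n \<times> 'n) ^ ('n \<times> 'n) \<Rightarrow> 'n falg" where
  "Rtrace2 M = trace (const_mat (tensor_square C) ** M)"

lemma Rtrace2_cong: "mat_eq R M N \<Longrightarrow> alg_eq R (Rtrace2 M) (Rtrace2 N)"
  unfolding Rtrace2_def trace_const_mat mat_eq_def by (intro alg_eq_sum alg_eq_scl) blast

lemma Rtrace2_linear:
  "Rtrace2 (M + N) = Rtrace2 M + Rtrace2 N" "Rtrace2 (M - N) = Rtrace2 M - Rtrace2 N"
  "Rtrace2 (- M) = - Rtrace2 M" "Rtrace2 (smat c M) = scl c (Rtrace2 M)" "Rtrace2 0 = 0"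
  by (simp_all add: Rtrace2_def trace_const_mat smat_def map_mat_def scl.scale_right_distrib
       scl.scale_right_diff_distrib sum.distrib sum_subtractf sum_negf scl.scale_sum_right mult.commute)
    (simp add: trace_def)

lemma Rtrace2_RR: "Rtrace2 (RR ** M) = Rtrace2 (M ** RR)"
proof -
  let ?C = "const_mat (tensor_square C) :: 'n falg ^ ('n \<times> 'n) ^ ('n \<times> 'n)"
  have "?C ** RR = RR ** ?C"
    by (simp add: const_mat_mult[symmetric] R_commutes_C_C)
  then have "Rtrace2 (RR ** M) = trace (RR ** (?C ** M))"
    by (simp add: Rtrace2_def matrix_mul_assoc)
  also have "\<dots> = trace ((?C ** M) ** RR)"
    by (rule trace_const_mat_commute)
  also have "\<dots> = Rtrace2 (M ** RR)"
    by (simp add: Rtrace2_def matrix_mul_assoc)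
  finally show ?thesis .
qed

lemma R_trace_eq: "R_trace \<Psi> A = (\<Sum>a\<in>UNIV. \<Sum>d\<in>UNIV. scl (C $ a $ d) (A $ d $ a))"
  by (simp add: R_trace_def trace_const_mat)

text \<open>Apart from \<open>C\<^sub>2\<close> only \<open>R\<close> involves the second space, and \<open>Tr\<^sub>2 (C\<^sub>2 R) = I\<close>.\<close>

lemma Rtrace2_bar1_RR_bar1: "Rtrace2 (bar1 A ** RR ** bar1 B) = R_trace \<Psi> (A ** B)"
proof -
  have entry: "(bar1 A ** RR ** bar1 B) $ (d, e) $ (a, b) =
      (\<Sum>x\<in>UNIV. \<Sum>y\<in>UNIV. scl (R $ (x, e) $ (y, b)) (A $ d $ x * B $ y $ a))" for a b d e
    by (simp add: matrix_matrix_mult_def bar1_def const_mat_def sum_UNIV_prod mult_if_zero sum_if_const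
        mult_single_zero sum_distrib_right scl_mult_left if_distrib[of "scl _"] cong: if_cong) (rule sum.swap)
  have "Rtrace2 (bar1 A ** RR ** bar1 B) = (\<Sum>a\<in>UNIV. \<Sum>b\<in>UNIV. \<Sum>d\<in>UNIV. \<Sum>e\<in>UNIV. \<Sum>x\<in>UNIV. \<Sum>y\<in>UNIV.
      scl (C $ a $ d * (C $ b $ e * R $ (x, e) $ (y, b))) (A $ d $ x * B $ y $ a))"
    unfolding Rtrace2_def trace_const_mat sum_UNIV_prod entry
    by (simp add: tensor_square_def scl.scale_sum_right mult.assoc)
  also have "\<dots> = (\<Sum>a\<in>UNIV. \<Sum>d\<in>UNIV. \<Sum>x\<in>UNIV. \<Sum>y\<in>UNIV. \<Sum>b\<in>UNIV. \<Sum>e\<in>UNIV.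
      scl (C $ a $ d * (C $ b $ e * R $ (x, e) $ (y, b))) (A $ d $ x * B $ y $ a))"
    by (simp only: sum.cartesian_product UNIV_Times_UNIV,
        rule sum.reindex_bij_witness[of _ "\<lambda>(a, d, x, y, b, e). (a, b, d, e, x, y)" "\<lambda>(a, b, d, e, x, y). (a, d, x, y, b, e)"]) auto
  also have "\<dots> = (\<Sum>a\<in>UNIV. \<Sum>d\<in>UNIV. \<Sum>x\<in>UNIV. \<Sum>y\<in>UNIV.
      scl (C $ a $ d * (if x = y then 1 else 0)) (A $ d $ x * B $ y $ a))"
    by (simp only: scl.scale_sum_left[symmetric] sum_distrib_left[symmetric] ptrace_C_R)
  also have "\<dots> = (\<Sum>a\<in>UNIV. \<Sum>d\<in>UNIV. \<Sum>x\<in>UNIV. \<Sum>y\<in>UNIV.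
      if x = y then scl (C $ a $ d) (A $ d $ x * B $ y $ a) else 0)"
    by (intro sum.cong refl) auto
  also have "\<dots> = R_trace \<Psi> (A ** B)"
    by (simp add: R_trace_eq matrix_matrix_mult_def scl.scale_sum_right)
  finally show ?thesis .
qed

lemma ptrace_bar2:
  "(\<Sum>b\<in>UNIV. \<Sum>e\<in>UNIV. scl (C $ b $ e) (bar2 R B $ (x, e) $ (a, b))) = (if x = a then R_trace \<Psi> B else 0)"
proof -
  have entry: "bar2 R B $ (x, e) $ (a, b) =
      (\<Sum>q\<in>UNIV. \<Sum>y\<in>UNIV. \<Sum>p\<in>UNIV. scl (R $ (x, e) $ (p, y) * R $ (q, y) $ (a, b)) (B $ p $ q))" for e b
    by (simp add: bar2_eq matrix_matrix_mult_def bar1_def const_mat_def sum_UNIV_prod mult_if_zero sum_if_const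
        mult_single_zero scl_def[symmetric] scl.scale_sum_right mult.commute)
  have "(\<Sum>b\<in>UNIV. \<Sum>e\<in>UNIV. scl (C $ b $ e) (bar2 R B $ (x, e) $ (a, b))) =
     (\<Sum>b\<in>UNIV. \<Sum>e\<in>UNIV. \<Sum>q\<in>UNIV. \<Sum>y\<in>UNIV. \<Sum>p\<in>UNIV. scl (C $ b $ e * (R $ (x, e) $ (p, y) * R $ (q, y) $ (a, b))) (B $ p $ q))"
    by (simp add: entry scl.scale_sum_right)
  also have "\<dots> = (\<Sum>q\<in>UNIV. \<Sum>p\<in>UNIV. \<Sum>b\<in>UNIV. \<Sum>e\<in>UNIV. \<Sum>y\<in>UNIV. scl (C $ b $ e * (R $ (x, e) $ (p, y) * R $ (q, y) $ (a, b))) (B $ p $ q))"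
    by (simp only: sum.cartesian_product UNIV_Times_UNIV,
        rule sum.reindex_bij_witness[of _ "\<lambda>(q, p, b, e, y). (b, e, q, y, p)" "\<lambda>(b, e, q, y, p). (q, p, b, e, y)"]) auto
  also have "\<dots> = (\<Sum>q\<in>UNIV. \<Sum>p\<in>UNIV. scl (if x = a then C $ q $ p else 0) (B $ p $ q))"
    by (simp only: scl.scale_sum_left[symmetric] ptrace_C_R_conj)
  finally show ?thesis by (simp add: R_trace_eq)
qed

text \<open>
  Tracing out the second space turns the factor \<open>B\<^sub>2'\<close> into the scalar matrix \<open>Tr\<^sup>R B\<close> by
  \<open>ptrace_bar2\<close>; the rest is \<open>Tr\<^sup>R A\<close>.
\<close>

lemma trace_tensor_square_odot:
  "trace (const_mat (tensor_square C) ** (bar1 A \<odot> bar2 R B)) = R_trace \<Psi> A \<otimes> R_trace \<Psi> B"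
proof -
  have entry: "(bar1 A \<odot> bar2 R B) $ (d, e) $ (a, b) = (\<Sum>x\<in>UNIV. (A $ d $ x) \<otimes> (bar2 R B $ (x, e) $ (a, b)))" for a b d e
  proof -
    have "(bar1 A \<odot> bar2 R B) $ (d, e) $ (a, b) =
      (\<Sum>x\<in>UNIV. \<Sum>y\<in>UNIV. if e = y then (A $ d $ x) \<otimes> (bar2 R B $ (x, y) $ (a, b)) else 0)"
      unfolding odot_def bar1_def vec_lambda_beta sum_UNIV_prod by (intro sum.cong refl) auto
    then show ?thesis by simp
  qed
  have "trace (const_mat (tensor_square C) ** (bar1 A \<odot> bar2 R B)) =
      (\<Sum>a\<in>UNIV. \<Sum>b\<in>UNIV. \<Sum>d\<in>UNIV. \<Sum>e\<in>UNIV. \<Sum>x\<in>UNIV. scl (C $ a $ d) ((A $ d $ x) \<otimes> scl (C $ b $ e) (bar2 R B $ (x, e) $ (a, b))))"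
    unfolding trace_const_mat sum_UNIV_prod entry
    by (simp add: tensor_square_def scl.scale_sum_right tens_scl_right)
  also have "\<dots> = (\<Sum>a\<in>UNIV. \<Sum>d\<in>UNIV. \<Sum>x\<in>UNIV. \<Sum>b\<in>UNIV. \<Sum>e\<in>UNIV. scl (C $ a $ d) ((A $ d $ x) \<otimes> scl (C $ b $ e) (bar2 R B $ (x, e) $ (a, b))))"
    by (simp only: sum.cartesian_product UNIV_Times_UNIV,
        rule sum.reindex_bij_witness[of _ "\<lambda>(a, d, x, b, e). (a, b, d, e, x)" "\<lambda>(a, b, d, e, x). (a, d, x, b, e)"]) auto
  also have "\<dots> = (\<Sum>a\<in>UNIV. \<Sum>d\<in>UNIV. \<Sum>x\<in>UNIV. scl (C $ a $ d) ((A $ d $ x) \<otimes> (if x = a then R_trace \<Psi> B else 0)))"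
    by (simp only: scl.scale_sum_right[symmetric] tens_sum_right[symmetric] ptrace_bar2)
  also have "\<dots> = (\<Sum>a\<in>UNIV. \<Sum>d\<in>UNIV. \<Sum>x\<in>UNIV. if x = a then scl (C $ a $ d) ((A $ d $ x) \<otimes> R_trace \<Psi> B) else 0)"
    by (intro sum.cong refl) auto
  also have "\<dots> = R_trace \<Psi> A \<otimes> R_trace \<Psi> B"
    by (simp add: R_trace_eq[of A] tens_sum_left tens_scl_left)
  finally show ?thesis .
qed

lemma Rtrace2_bars_RR: "Rtrace2 (bar1 A ** bar2 R B ** RR) = R_trace \<Psi> (A ** B)"
  by (simp add: Rtrace2_bar1_RR_bar1[symmetric] RR_bar)

text \<open>
  The interchange of \<open>A\<^sub>1\<close> and \<open>B\<^sub>2'\<close> is a relation of the algebra, and conjugation by \<open>R\<close>, under which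
  \<open>\<tau>\<close> is invariant, exchanges the roles of the two spaces.
\<close>

lemma R_trace_cyclic:
  assumes "A \<in> monomials" "B \<in> monomials"
  shows "alg_eq R (R_trace \<Psi> (A ** B)) (R_trace \<Psi> (B ** A))"
proof -
  have "R_trace \<Psi> (A ** B) = Rtrace2 (bar1 A ** bar2 R B ** RR)"
    by (simp add: Rtrace2_bars_RR)
  also have "alg_eq R \<dots> (Rtrace2 (bar2 R B ** bar1 A ** RR))"
    by (intro Rtrace2_cong mat_eq_mult mat_eq_refl monomials_commute assms)
  also have "Rtrace2 (bar2 R B ** bar1 A ** RR) = Rtrace2 (RR ** (bar1 B ** bar2 R A))"
    by (simp add: matrix_mul_assoc RR_bar)
  also have "\<dots> = R_trace \<Psi> (B ** A)"
    by (simp add: Rtrace2_RR Rtrace2_bars_RR)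
  finally show ?thesis .
qed

section \<open>Matrices annihilated by the R-trace\<close>

abbreviation Lp :: "nat \<Rightarrow> 'n falg ^ 'n ^ 'n" where "Lp k \<equiv> mpow (L_mat 0) k"

lemma Lp_monomial: "Lp k \<in> monomials"
  by (intro mpow_monomial L_mat_monomial)

text \<open>
  The factors on both sides make the vanishing stable under all operations by which brackets of
  powers of \<open>L\<close> arise from brackets of generators: multiplication by powers of \<open>L\<^sub>2'\<close>, conjugation
  by \<open>R\<close>, and linear combinations.
\<close>

definition trace_null :: "'n falg ^ ('n \<times> 'n) ^ ('n \<times> 'n) \<Rightarrow> bool" where
  "trace_null M \<longleftrightarrow> (\<forall>a b c d.
     alg_eq R (Rtrace2 (bar1 (Lp a) ** bar2 R (Lp b) ** M ** bar1 (Lp c) ** bar2 R (Lp d))) 0)"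

lemma trace_null_cong:
  assumes "mat_eq R M N" "trace_null N"
  shows "trace_null M"
  unfolding trace_null_def
proof (intro allI)
  fix a b c d :: nat
  have "alg_eq R (Rtrace2 (bar1 (Lp a) ** bar2 R (Lp b) ** M ** bar1 (Lp c) ** bar2 R (Lp d)))
     (Rtrace2 (bar1 (Lp a) ** bar2 R (Lp b) ** N ** bar1 (Lp c) ** bar2 R (Lp d)))"
    by (intro Rtrace2_cong mat_eq_mult mat_eq_refl assms)
  also have "alg_eq R \<dots> 0" using assms(2) by (simp add: trace_null_def)
  finally show "alg_eq R (Rtrace2 (bar1 (Lp a) ** bar2 R (Lp b) ** M ** bar1 (Lp c) ** bar2 R (Lp d))) 0" .
qed

lemma trace_null_zero: "trace_null 0"
  by (simp add: trace_null_def Rtrace2_linear)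

lemma trace_null_add: "trace_null M \<Longrightarrow> trace_null N \<Longrightarrow> trace_null (M + N)"
proof -
  have distrib: "Y ** (M + N) = Y ** M + Y ** N" "(M + N) ** Y = M ** Y + N ** Y"
    for Y M N :: "'n falg ^ ('n \<times> 'n) ^ ('n \<times> 'n)"
    by (simp_all add: matrix_matrix_mult_def vec_eq_iff algebra_simps sum.distrib)
  show "trace_null M \<Longrightarrow> trace_null N \<Longrightarrow> trace_null (M + N)"
    unfolding trace_null_def distrib Rtrace2_linear
    using alg_eq_add[of R _ 0 _ 0] by simp
qed

lemma smat_mult: "smat c M ** N = smat c (M ** N)" "N ** smat c M = smat c (N ** M)"
  by (simp_all add: smat_def map_mat_def vec_eq_iff matrix_matrix_mult_def scl_mult_left scl_mult_right scl.scale_sum_right)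

lemma trace_null_smat: "trace_null M \<Longrightarrow> trace_null (smat c M)"
  unfolding trace_null_def
  using alg_eq_scl[of R _ 0 c] by (simp add: smat_mult Rtrace2_linear)

lemma smat_minus_one: "- M = smat (- 1) M"
  by (simp add: smat_def map_mat_def vec_eq_iff)

lemma trace_null_uminus: "trace_null M \<Longrightarrow> trace_null (- M)"
  unfolding smat_minus_one by (rule trace_null_smat)

lemma trace_null_bar2_left: "trace_null M \<Longrightarrow> trace_null (bar2 R (Lp k) ** M)"
  unfolding trace_null_def
proof (intro allI)
  fix a b c d :: nat
  assume "\<forall>a b c d. alg_eq R (Rtrace2 (bar1 (Lp a) ** bar2 R (Lp b) ** M ** bar1 (Lp c) ** bar2 R (Lp d))) 0"
  then have "alg_eq R (Rtrace2 (bar1 (Lp a) ** bar2 R (Lp (b + k)) ** M ** bar1 (Lp c) ** bar2 R (Lp d))) 0"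
    by blast
  then show "alg_eq R (Rtrace2 (bar1 (Lp a) ** bar2 R (Lp b) ** (bar2 R (Lp k) ** M) ** bar1 (Lp c) ** bar2 R (Lp d))) 0"
    by (simp add: mpow_add bar2_mult matrix_mul_assoc)
qed

lemma trace_null_bar2_right:
  assumes "trace_null M"
  shows "trace_null (M ** bar2 R (Lp k))"
  unfolding trace_null_def
proof (intro allI)
  fix a b c d :: nat
  have "Rtrace2 (bar1 (Lp a) ** bar2 R (Lp b) ** (M ** bar2 R (Lp k)) ** bar1 (Lp c) ** bar2 R (Lp d)) =
        Rtrace2 (bar1 (Lp a) ** bar2 R (Lp b) ** M ** (bar2 R (Lp k) ** bar1 (Lp c)) ** bar2 R (Lp d))"
    by (simp add: matrix_mul_assoc)
  also have "alg_eq R \<dots> (Rtrace2 (bar1 (Lp a) ** bar2 R (Lp b) ** M ** (bar1 (Lp c) ** bar2 R (Lp k)) ** bar2 R (Lp d)))"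
    by (intro Rtrace2_cong mat_eq_mult mat_eq_refl mat_eq_sym[OF monomials_commute] Lp_monomial)
  also have "\<dots> = Rtrace2 (bar1 (Lp a) ** bar2 R (Lp b) ** M ** bar1 (Lp c) ** bar2 R (Lp (k + d)))"
    by (simp add: mpow_add bar2_mult matrix_mul_assoc)
  also have "alg_eq R \<dots> 0"
    using assms by (simp add: trace_null_def)
  finally show "alg_eq R (Rtrace2 (bar1 (Lp a) ** bar2 R (Lp b) ** (M ** bar2 R (Lp k)) ** bar1 (Lp c) ** bar2 R (Lp d))) 0" .
qed

text \<open>
  \<open>R\<close> is moved outwards on both sides, where \<open>\<tau>\<close> cancels it.  This interchanges the bars of the outer
  factors, and commutation restores their order.
\<close>

lemma trace_null_conj:
  assumes "trace_null M"
  shows "trace_null (RR ** M ** RR)"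
  unfolding trace_null_def
proof (intro allI)
  fix a b c d :: nat
  have "Rtrace2 (bar1 (Lp a) ** bar2 R (Lp b) ** (RR ** M ** RR) ** bar1 (Lp c) ** bar2 R (Lp d)) =
    Rtrace2 (RR ** (bar2 R (Lp a) ** bar1 (Lp b) ** M ** bar2 R (Lp c) ** bar1 (Lp d) ** RR))"
    by (simp add: matrix_mul_assoc RR_bar)
  also have "\<dots> = Rtrace2 ((bar2 R (Lp a) ** bar1 (Lp b)) ** M ** (bar2 R (Lp c) ** bar1 (Lp d)))"
    unfolding Rtrace2_RR by (simp only: RR_RR matrix_mul_assoc)
  also have "alg_eq R \<dots> (Rtrace2 ((bar1 (Lp b) ** bar2 R (Lp a)) ** M ** (bar1 (Lp d) ** bar2 R (Lp c))))"
    by (intro Rtrace2_cong mat_eq_mult mat_eq_refl mat_eq_sym[OF monomials_commute] Lp_monomial)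
  also have "alg_eq R \<dots> 0"
    using assms by (simp add: trace_null_def matrix_mul_assoc)
  finally show "alg_eq R (Rtrace2 (bar1 (Lp a) ** bar2 R (Lp b) ** (RR ** M ** RR) ** bar1 (Lp c) ** bar2 R (Lp d))) 0" .
qed

text \<open>
  After \<open>R\<close> has been moved to the right, both terms are \<open>R\<close>-traces of products of one factor \<open>X\<close> and
  \<open>N\<close> factors \<open>L\<close>.  Such a trace does not depend on the position of \<open>X\<close>, by cyclicity.
\<close>

lemma trace_null_commutator:
  assumes X: "X \<in> monomials"
  shows "trace_null (bar1 X ** RR - RR ** bar1 X)"
  unfolding trace_null_def
proof (intro allI)
  fix a b c d :: nat
  let ?N = "a + b + c + d"
  note mono = monomials_mult Lp_monomial X
  have "Rtrace2 (bar1 (Lp a) ** bar2 R (Lp b) ** (bar1 X ** RR) ** bar1 (Lp c) ** bar2 R (Lp d)) =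
      Rtrace2 (bar1 (Lp a) ** (bar2 R (Lp b) ** bar1 X) ** (bar2 R (Lp c) ** bar1 (Lp d)) ** RR)"
    by (simp add: matrix_mul_assoc RR_bar)
  also have "alg_eq R \<dots> (Rtrace2 (bar1 (Lp a) ** (bar1 X ** bar2 R (Lp b)) ** (bar1 (Lp d) ** bar2 R (Lp c)) ** RR))"
    by (intro Rtrace2_cong mat_eq_mult mat_eq_refl mat_eq_sym[OF monomials_commute] mono)
  also have "\<dots> = Rtrace2 (bar1 (Lp a) ** bar1 X ** (bar2 R (Lp b) ** bar1 (Lp d)) ** bar2 R (Lp c) ** RR)"
    by (simp add: matrix_mul_assoc)
  also have "alg_eq R \<dots> (Rtrace2 (bar1 (Lp a) ** bar1 X ** (bar1 (Lp d) ** bar2 R (Lp b)) ** bar2 R (Lp c) ** RR))"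
    by (intro Rtrace2_cong mat_eq_mult mat_eq_refl mat_eq_sym[OF monomials_commute] mono)
  also have "\<dots> = Rtrace2 (bar1 (Lp a ** X ** Lp d) ** bar2 R (Lp b ** Lp c) ** RR)"
    by (simp add: bar1_mult bar2_mult matrix_mul_assoc)
  also have "\<dots> = R_trace \<Psi> (Lp a ** (X ** (Lp d ** Lp b ** Lp c)))"
    by (simp only: Rtrace2_bars_RR matrix_mul_assoc)
  also have "alg_eq R \<dots> (R_trace \<Psi> ((X ** (Lp d ** Lp b ** Lp c)) ** Lp a))"
    by (intro R_trace_cyclic mono)
  also have "\<dots> = R_trace \<Psi> (X ** Lp ?N)"
    by (simp add: matrix_mul_assoc[symmetric] mpow_add[symmetric] ac_simps)
  finally have 1: "alg_eq R (Rtrace2 (bar1 (Lp a) ** bar2 R (Lp b) ** (bar1 X ** RR) ** bar1 (Lp c) ** bar2 R (Lp d)))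
     (R_trace \<Psi> (X ** Lp ?N))" .
  have "Rtrace2 (bar1 (Lp a) ** bar2 R (Lp b) ** (RR ** bar1 X) ** bar1 (Lp c) ** bar2 R (Lp d)) =
      Rtrace2 (bar1 (Lp a) ** (bar2 R (Lp b ** X ** Lp c) ** bar1 (Lp d)) ** RR)"
    by (simp add: matrix_mul_assoc RR_bar bar2_mult)
  also have "alg_eq R \<dots> (Rtrace2 (bar1 (Lp a) ** (bar1 (Lp d) ** bar2 R (Lp b ** X ** Lp c)) ** RR))"
    by (intro Rtrace2_cong mat_eq_mult mat_eq_refl mat_eq_sym[OF monomials_commute] mono)
  also have "\<dots> = Rtrace2 (bar1 (Lp a ** Lp d) ** bar2 R (Lp b ** X ** Lp c) ** RR)"
    by (simp add: bar1_mult matrix_mul_assoc)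
  also have "\<dots> = R_trace \<Psi> ((Lp a ** Lp d ** Lp b) ** (X ** Lp c))"
    by (simp only: Rtrace2_bars_RR matrix_mul_assoc)
  also have "alg_eq R \<dots> (R_trace \<Psi> ((X ** Lp c) ** (Lp a ** Lp d ** Lp b)))"
    by (intro R_trace_cyclic mono)
  also have "\<dots> = R_trace \<Psi> (X ** Lp ?N)"
    by (simp add: matrix_mul_assoc[symmetric] mpow_add[symmetric] ac_simps)
  finally have 2: "alg_eq R (Rtrace2 (bar1 (Lp a) ** bar2 R (Lp b) ** (RR ** bar1 X) ** bar1 (Lp c) ** bar2 R (Lp d)))
     (R_trace \<Psi> (X ** Lp ?N))" .
  have diff: "Y ** (M - N) = Y ** M - Y ** N" "(M - N) ** Y = M ** Y - N ** Y"
    for Y M N :: "'n falg ^ ('n \<times> 'n) ^ ('n \<times> 'n)"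
    by (simp_all add: matrix_matrix_mult_def vec_eq_iff algebra_simps sum_subtractf)
  show "alg_eq R (Rtrace2 (bar1 (Lp a) ** bar2 R (Lp b) ** (bar1 X ** RR - RR ** bar1 X) ** bar1 (Lp c) ** bar2 R (Lp d))) 0"
    using alg_eq_diff[OF 1 2] by (simp only: diff Rtrace2_linear diff_self)
qed

end

section \<open>Brackets of R-traces of powers\<close>

locale braided_bracket_setting = skew_invertible_symmetry R \<Psi> + braided_poisson_algebra R Q r br
  for R \<Psi> :: "'n::finite op2" and Q r br
begin

lemma br_R_traces:
  "br (R_trace \<Psi> A \<otimes> R_trace \<Psi> B) = Rtrace2 (bracket_mat br (bar1 A) (bar2 R B))"
proof -
  have "br (trace M) = trace (map_mat br M)" for M :: "'n falg2 ^ ('n \<times> 'n) ^ ('n \<times> 'n)"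
    by (simp add: trace_def map_mat_def scl_linear_sum[OF br_linear])
  then show ?thesis
    by (simp add: trace_tensor_square_odot[symmetric] Rtrace2_def bracket_mat_def map_mat_linear_mult_const[OF br_linear])
qed

lemma trace_null_bracket_leibniz:
  assumes "passes A (bar2 R (L_mat 0))" "trace_null (bracket_mat br A (bar2 R (L_mat 0)))"
  shows "trace_null (bracket_mat br A (bar2 R (Lp l)))"
proof (induction l)
  case 0
  show ?case
    using trace_null_cong[OF bracket_mat_one trace_null_zero] by (simp add: mpow_0 bar2_one)
next
  case (Suc l)
  have "trace_null (bracket_mat br A (bar2 R (L_mat 0)) ** bar2 R (Lp l))"
    by (intro trace_null_bar2_right assms)
  moreover have "trace_null (bar2 R (L_mat 0) ** bracket_mat br A (bar2 R (Lp l)))"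
    using trace_null_bar2_left[OF Suc, of 1] by (simp add: mpow_0 mpow_Suc)
  ultimately show ?case
    unfolding mpow_Suc bar2_mult
    by (intro trace_null_cong[OF bracket_mat_leibniz[OF assms(1)]] trace_null_add)
qed

lemma passes_Lp: "passes (bar1 (Lp k)) (bar2 R (L_mat 0))"
proof (induction k)
  case (Suc k)
  have "passes (bar1 (L_mat 0)) (bar2 R (L_mat 0))"
    unfolding passes_def by (rule Q_gen)
  with Suc show ?case
    by (simp add: mpow_Suc bar1_mult passes_mult_left)
qed (simp add: mpow_0 bar1_one passes_one)

lemma trace_null_generator_bracket: "trace_null (bracket_mat br (bar1 (L_mat 0)) (bar2 R (Lp k)))"
proof (rule trace_null_bracket_leibniz)
  show "passes (bar1 (L_mat 0)) (bar2 R (L_mat 0))"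
    using passes_Lp[of 1] by (simp add: mpow_0 mpow_Suc)
  show "trace_null (bracket_mat br (bar1 (L_mat 0)) (bar2 R (L_mat 0)))"
    by (rule trace_null_cong[OF br_gen trace_null_smat[OF trace_null_commutator[OF L_mat_monomial]]])
qed

text \<open>
  Induction on the second exponent reduces to \<open>{(L\<^sup>k)\<^sub>1, L\<^sub>2'}\<close>.  By skew-symmetry this is
  \<open>- {L\<^sub>2', (L\<^sup>k)\<^sub>1} = - R {L\<^sub>1, (L\<^sup>k)\<^sub>2'} R\<close>, where the power is in the second argument again.
\<close>

lemma trace_null_bracket_powers: "trace_null (bracket_mat br (bar1 (Lp k)) (bar2 R (Lp l)))"
proof (rule trace_null_bracket_leibniz[OF passes_Lp])
  have "bar1 (Lp k) = RR ** (bar2 R (Lp k) ** RR)"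
    by (simp add: matrix_mul_assoc RR_bar RR_RR)
  moreover have "bar2 R (L_mat 0) = RR ** (bar1 (L_mat 0) ** RR)"
    by (simp add: bar2_eq matrix_mul_assoc)
  ultimately have "bracket_mat br (bar2 R (L_mat 0)) (bar1 (Lp k)) =
      bracket_mat br (RR ** (bar1 (L_mat 0) ** RR)) (RR ** (bar2 R (Lp k) ** RR))"
    by metis
  also have "\<dots> = RR ** bracket_mat br (bar1 (L_mat 0)) (bar2 R (Lp k)) ** RR"
    by (simp only: bracket_mat_const[OF br_linear] matrix_mul_assoc RR_RR matrix_mul_lid)
  finally have "mat_eq R (bracket_mat br (bar1 (Lp k)) (bar2 R (L_mat 0)))
      (- (RR ** bracket_mat br (bar1 (L_mat 0)) (bar2 R (Lp k)) ** RR))"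
    using bracket_mat_skew[OF passes_Lp[of k]] by simp
  then show "trace_null (bracket_mat br (bar1 (Lp k)) (bar2 R (L_mat 0)))"
    by (rule trace_null_cong) (intro trace_null_uminus trace_null_conj trace_null_generator_bracket)
qed

lemma R_trace_powers_commute: "alg_eq R (br (R_trace \<Psi> (Lp k) \<otimes> R_trace \<Psi> (Lp l))) 0"
  using trace_null_bracket_powers[of k l, unfolded trace_null_def, rule_format, of 0 0 0 0]
  by (simp add: br_R_traces mpow_0 bar1_one bar2_one)

end

theorem proposition13:
  fixes R \<Psi> :: "complex ^ ('n::finite \<times> 'n) ^ ('n \<times> 'n)"
    and r :: nat
    and Q :: "'n falg2 \<Rightarrow> 'n falg2"
    and br :: "'n falg2 \<Rightarrow> 'n falg"
  assumes "involutive_symmetry R"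
    and "skew_inverse R \<Psi>"
    and "r \<ge> 2"
    and "algebra_braiding R Q"
    and "braided_bracket R r Q br"
  shows "\<forall>k l. alg_eq R
    (br (R_trace \<Psi> (mpow (L_mat 0) k) \<otimes> R_trace \<Psi> (mpow (L_mat 0) l))) 0"
proof -
  interpret braided_bracket_setting R \<Psi> Q r br
    by unfold_locales (fact assms)+
  show ?thesis using R_trace_powers_commute by blast
qed

end
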